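(* Let $P$ be an $m$-th order plant with a lag, with state-space matrices $\mathbf{A},\mathbf{B},\mathbf{C}$ and dual system matrix $\mathbf{A}^{\ast}$ as defined in the context. Let $S_k\subset\mathbb{R}^m$ be the uncertainty set at time $k$, that is, the closed convex polytope of possible states at time $k$ consistent with the known initial state and the measurements $z_0,\dots,z_{k-1}$. Let $z_k$ be the new measurement, and let $$S_{k+1}=\{\mathbf{A}\mathbf{x}+\mathbf{B}u_k:\ \mathbf{x}\in S_k,\ |u_k|\le 1,\ |\mathbf{C}\mathbf{x}-z_k|\le 1\}$$ be the uncertainty set at time $k+1$. Let $S_k$ have vertices $\mathbf{v}_1,\dots,\mathbf{v}_{n_v}$, facets $F_1,\dots,F_{n_f}$ with directions $\mathbf{f}_1,\dots,\mathbf{f}_{n_f}$, and vertex-facet incidence matrix $\mathcal{I}\in\{0,1\}^{n_f\times n_v}$. Let $R_1,\dots,R_{n_R}$ be the ridges in the set $R$, with associated directions $\mathbf{f}^R_1,\dots,\mathbf{f}^R_{n_R}$ (see context). Define the $(3n_f+n_R)\times 2n_v$ zero-one matrix $$\mathcal{I}^+=\begin{bmatrix}\mathcal{I}^{\mathrm T}&\mathbf{0}\\ \mathbf{0}&\mathcal{I}^{\mathrm B}\\ \mathcal{I}O^{\mathrm T}&\mathcal{I}O^{\mathrm B}\\ \mathcal{I}R^{\mathrm T}&\mathcal{I}R^{\mathrm B}\end{bmatrix},$$ whose blocks are defined in the context. Column $j$ ($1\le j\le n_v$) points to the state $g^{\mathrm T}(\mathbf{v}_j)=\mathbf{A}\mathbf{v}_j+\mathbf{B}$,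 and column $n_v+j$ points to the state $g^{\mathrm B}(\mathbf{v}_j)=\mathbf{A}\mathbf{v}_j-\mathbf{B}$. Row $i$ of each of the first three row blocks points to the facet direction $\mathbf{A}^{\ast}\mathbf{f}_i$, and row $l$ of the last row block points to the facet direction $\mathbf{A}^{\ast}\mathbf{f}^R_l$. Then, after removal of all rows and columns consisting entirely of zeros, $\mathcal{I}^+$ is the vertex-facet incidence matrix of $S_{k+1}$, the remaining columns pointing to the vertices of $S_{k+1}$ and the remaining rows to the facets of $S_{k+1}$ (with the indicated directions).
   Context: Plant. $m\ge 1$; $\hat{\mathbf n}(\lambda)=n_0+n_1\lambda+\dots+n_m\lambda^m$ and $\hat{\mathbf d}(\lambda)=d_0+d_1\lambda+\dots+d_m\lambda^m$ are coprime real polynomials with $n_0=0$ (the plant has a lag), $d_0=1$ and $d_m\neq 0$; the plant has transfer function $\hat{\mathbf n}/\hat{\mathbf d}$, with $\lambda$ the unit delay. The state-space description is $\mathbf{x}_{k+1}=\mathbf{A}\mathbf{x}_k+\mathbf{B}u_k$, $y_k=\mathbf{C}\mathbf{x}_k$, with measurement $z_k=y_k+w_k$, where the input disturbance and measurement noise are unknown except that $|u_k|\le 1$ and $|w_k|\le 1$. The initial state $\mathbf{x}_0$ is known exactly. Here: - $\mathbf{A}\in\mathbb{R}^{m\times m}$ is given by $(\mathbf{A}\mathbf{x})_i=(\mathbf{x})_{i+1}$ for $i<m$ and $(\mathbf{A}\mathbf{x})_m=-d_m(\mathbf{x})_1-d_{m-1}(\mathbf{x})_2-\dots-d_1(\mathbf{x})_m$;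 - $\mathbf{B}=(0,\dots,0,1)^{T}$; - $\mathbf{C}=[n_m,\dots,n_1]$. The dual system matrix $\mathbf{A}^{\ast}\in\mathbb{R}^{m\times m}$ has first column $(-d_{m-1}/d_m,\,-d_{m-2}/d_m,\dots,-d_1/d_m,\,-1/d_m)^{T}$, and its remaining $m-1$ columns are the identity matrix $\mathbf{I}_{m-1}$ stacked above a zero row. Polytopes. For a convex polytope in $\mathbb{R}^m$, a face is its intersection with a supporting hyperplane; a facet is a face of dimension $m-1$; a ridge is a face of dimension $m-2$; a vertex is a face of dimension $0$. The direction of a facet is its (non-zero) outward normal vector, determined up to a positive scalar multiple. The vertex-facet incidence matrix has one row per facet and one column per vertex, with entry $\mathcal{I}(i,j)=1$ if the $j$-th vertex lies in the $i$-th facet and $0$ otherwise. $(\mathbf{f})_1$ denotes the first component of the vector $\mathbf{f}$. Ridges. $R=\{R_1,\dots,R_{n_R}\}$ is the set of ridges of $S_k$ that are the intersection of two facets $F,F'$ of $S_k$ whose directions $\mathbf{f},\mathbf{f}'$ satisfy $(\mathbf{f})_1<0$ and $(\mathbf{f}')_1>0$. For $R_l\in R$, $\mathbf{f}^R_l$ is the direction in the convex hull of these $\mathbf{f}$ and $\mathbf{f}'$ with $(\mathbf{f}^R_l)_1=0$. Blocks of $\mathcal{I}^+$ (all entries are $0$ unless specified to be $1$): - $\mathcal{I}^{\mathrm T}\in\{0,1\}^{n_f\times n_v}$: $\mathcal{I}^{\mathrm T}(i,j)=1$ if $\mathcal{I}(i,j)=1$ and $d_m(\mathbf{f}_i)_1<0$.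 - $\mathcal{I}^{\mathrm B}\in\{0,1\}^{n_f\times n_v}$: $\mathcal{I}^{\mathrm B}(i,j)=1$ if $\mathcal{I}(i,j)=1$ and $d_m(\mathbf{f}_i)_1>0$. - $\mathcal{I}V^{\mathrm{PT}}(j)=1$ if the $j$-th column of $\mathcal{I}^{\mathrm T}$ is not identically zero; $\mathcal{I}V^{\mathrm{PB}}(j)=1$ if the $j$-th column of $\mathcal{I}^{\mathrm B}$ is not identically zero. - $\mathcal{I}O^{\mathrm T}\in\{0,1\}^{n_f\times n_v}$: $\mathcal{I}O^{\mathrm T}(i,j)=1$ if $(\mathbf{f}_i)_1=0$, $\mathcal{I}V^{\mathrm{PT}}(j)=1$ and $\mathcal{I}(i,j)=1$. $\mathcal{I}O^{\mathrm B}$ is defined in the same way with $\mathcal{I}V^{\mathrm{PB}}$ in place of $\mathcal{I}V^{\mathrm{PT}}$. - $\mathcal{I}R^{\mathrm T}\in\{0,1\}^{n_R\times n_v}$: $\mathcal{I}R^{\mathrm T}(l,j)=1$ if $\mathbf{v}_j\in R_l$ and $\mathcal{I}V^{\mathrm{PT}}(j)=1$. $\mathcal{I}R^{\mathrm B}$ is defined in the same way with $\mathcal{I}V^{\mathrm{PB}}$ in place of $\mathcal{I}V^{\mathrm{PT}}$.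
   Formalization: The vertices, facets, ridges and incidence matrix are those of {x in S_k : |Cx - z_k| <= 1} instead of S_k (the claim fails when z_k cuts S_k), and this polytope is assumed to have dimension m, without which facet directions are not determined or there are no facets. *)

theory Defs
  imports "HOL-Analysis.Analysis" "HOL-Computational_Algebra.Polynomial"
begin

section \<open>The plant\<close>

text \<open>
  The space of dimension \<open>m\<close> is \<open>real ^ 'n\<close> with \<open>m = CARD('n)\<close>; the linear order on the
  index type identifies it with \<open>1, \<dots>, m\<close>.
\<close>

definition pos :: "'n::{finite,linorder} \<Rightarrow> nat" where
  "pos i = card {..i}"

definition first :: "real ^ 'n::{finite,linorder} \<Rightarrow> real" where
  "first x = x $ Min UNIV"

definition plant_A :: "real poly \<Rightarrow> real ^ 'n::{finite,linorder} ^ 'n::{finite,linorder}" where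
  "plant_A den = (\<chi> r c.
     if pos r < CARD('n) then (if pos c = pos r + 1 then 1 else 0)
     else - coeff den (CARD('n) + 1 - pos c))"

definition plant_B :: "real ^ 'n::{finite,linorder}" where
  "plant_B = (\<chi> r. if pos r = CARD('n) then 1 else 0)"

text \<open>The row vector \<open>C\<close>; the product \<open>C x\<close> is written as an inner product.\<close>

definition plant_C :: "real poly \<Rightarrow> real ^ 'n::{finite,linorder}" where
  "plant_C num = (\<chi> c. coeff num (CARD('n) + 1 - pos c))"

definition dual_A :: "real poly \<Rightarrow> real ^ 'n::{finite,linorder} ^ 'n::{finite,linorder}" where
  "dual_A den = (\<chi> r c.
     if pos c = 1 then
       (if pos r < CARD('n) then - coeff den (CARD('n) - pos r) / coeff den CARD('n)
        else - 1 / coeff den CARD('n))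
     else (if pos c = pos r + 1 then 1 else 0))"

text \<open>
  \<open>uncertainty_set num den x0 z k\<close>: the states at time \<open>k\<close> that are reached by some trajectory from
  \<open>x0\<close>, with admissible disturbance \<open>u\<close> and noise \<open>w\<close>, that produces the measurements
  \<open>z 0, \<dots>, z (k - 1)\<close>.
\<close>

definition uncertainty_set ::
    "real poly \<Rightarrow> real poly \<Rightarrow> real ^ 'n::{finite,linorder} \<Rightarrow> (nat \<Rightarrow> real) \<Rightarrow> nat \<Rightarrow> (real ^ 'n::{finite,linorder}) set"
  where
  "uncertainty_set num den x0 z k =
     {x k | x u w. x 0 = x0 \<and>
        (\<forall>i<k. \<bar>u i\<bar> \<le> 1 \<and> \<bar>w i\<bar> \<le> 1 \<and>
               z i = plant_C num \<bullet> x i + w i \<and>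
               x (Suc i) = plant_A den *v x i + u i *\<^sub>R plant_B)}"

lemma uncertainty_set_Suc:
  "uncertainty_set num den x0 z (Suc k) =
     {plant_A den *v x + u *\<^sub>R plant_B | x u.
        x \<in> uncertainty_set num den x0 z k \<and> \<bar>u\<bar> \<le> 1 \<and> \<bar>plant_C num \<bullet> x - z k\<bar> \<le> 1}"
  (is "?L = ?R")
proof (intro subset_antisym subsetI)
  fix y assume "y \<in> ?L"
  then obtain x u w where y: "y = x (Suc k)" and x0: "x 0 = x0"
    and s: "\<forall>i<Suc k. \<bar>u i\<bar> \<le> 1 \<and> \<bar>w i\<bar> \<le> 1 \<and> z i = plant_C num \<bullet> x i + w i \<and>
               x (Suc i) = plant_A den *v x i + u i *\<^sub>R plant_B"
    unfolding uncertainty_set_def by blast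
  have "x k \<in> uncertainty_set num den x0 z k"
    unfolding uncertainty_set_def using x0 s less_SucI by blast
  moreover have "\<bar>u k\<bar> \<le> 1" "\<bar>plant_C num \<bullet> x k - z k\<bar> \<le> 1"
    "y = plant_A den *v x k + u k *\<^sub>R plant_B"
    using s y by auto
  ultimately show "y \<in> ?R" by blast
next
  fix y assume "y \<in> ?R"
  then obtain p a where y: "y = plant_A den *v p + a *\<^sub>R plant_B"
    and p: "p \<in> uncertainty_set num den x0 z k"
    and a: "\<bar>a\<bar> \<le> 1" and c: "\<bar>plant_C num \<bullet> p - z k\<bar> \<le> 1" by blast
  from p obtain x u w where px: "p = x k" and x0: "x 0 = x0"
    and s: "\<forall>i<k. \<bar>u i\<bar> \<le> 1 \<and> \<bar>w i\<bar> \<le> 1 \<and> z i = plant_C num \<bullet> x i + w i \<and>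
               x (Suc i) = plant_A den *v x i + u i *\<^sub>R plant_B"
    unfolding uncertainty_set_def by blast
  let ?x = "x(Suc k := y)" and ?u = "u(k := a)" and ?w = "w(k := z k - plant_C num \<bullet> p)"
  have "\<forall>i<Suc k. \<bar>?u i\<bar> \<le> 1 \<and> \<bar>?w i\<bar> \<le> 1 \<and> z i = plant_C num \<bullet> ?x i + ?w i \<and>
          ?x (Suc i) = plant_A den *v ?x i + ?u i *\<^sub>R plant_B"
    using s a c y px by (auto simp: less_Suc_eq abs_minus_commute)
  moreover have "?x 0 = x0" "y = ?x (Suc k)" using x0 by auto
  ultimately show "y \<in> ?L" unfolding uncertainty_set_def by blast
qed


section \<open>Faces\<close>

text \<open>
  \<open>f\<close> is a (non-zero) outward normal vector of a supporting hyperplane of \<open>S\<close>, and that hyperplane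
  meets \<open>S\<close> in \<open>F\<close>. A supporting hyperplane meets \<open>S\<close>, so \<open>F\<close> is non-empty.
\<close>

definition supports :: "'a::euclidean_space set \<Rightarrow> 'a \<Rightarrow> 'a set \<Rightarrow> bool" where
  "supports S f F \<longleftrightarrow>
     f \<noteq> 0 \<and> F \<noteq> {} \<and> (\<exists>b. S \<subseteq> {x. f \<bullet> x \<le> b} \<and> F = S \<inter> {x. f \<bullet> x = b})"

definition face :: "'a::euclidean_space set \<Rightarrow> 'a set \<Rightarrow> bool" where
  "face S F \<longleftrightarrow> (\<exists>f. supports S f F)"

definition facet :: "'a::euclidean_space set \<Rightarrow> 'a set \<Rightarrow> bool" where
  "facet S F \<longleftrightarrow> face S F \<and> aff_dim F = int DIM('a) - 1"

definition ridge :: "'a::euclidean_space set \<Rightarrow> 'a set \<Rightarrow> bool" where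
  "ridge S F \<longleftrightarrow> face S F \<and> aff_dim F = int DIM('a) - 2"

definition vertex :: "'a::euclidean_space set \<Rightarrow> 'a \<Rightarrow> bool" where
  "vertex S v \<longleftrightarrow> face S {v}"

text \<open>
  \<open>M\<close>, with rows \<open>I\<close> and columns \<open>J\<close>, is the vertex-facet incidence matrix of \<open>S\<close>: the columns
  enumerate the vertices \<open>v j\<close>, the rows enumerate the facets \<open>F i\<close>, both without repetition, and
  \<open>f i\<close> is a direction of \<open>F i\<close>.
\<close>

definition incidence_matrix ::
    "'a::euclidean_space set \<Rightarrow> 'r set \<Rightarrow> 'c set \<Rightarrow> ('r \<Rightarrow> 'c \<Rightarrow> nat) \<Rightarrow>
     ('c \<Rightarrow> 'a) \<Rightarrow> ('r \<Rightarrow> 'a set) \<Rightarrow> ('r \<Rightarrow> 'a) \<Rightarrow> bool"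
  where
  "incidence_matrix S I J M v F f \<longleftrightarrow>
     bij_betw v J {p. vertex S p} \<and>
     bij_betw F I {G. facet S G} \<and>
     (\<forall>i\<in>I. supports S (f i) (F i)) \<and>
     (\<forall>i\<in>I. \<forall>j\<in>J. M i j = (if v j \<in> F i then 1 else 0))"

text \<open>The set \<open>R\<close>. It is empty for \<open>m = 1\<close>, faces being non-empty.\<close>

definition turning_ridges :: "(real ^ 'n::{finite,linorder}) set \<Rightarrow> (real ^ 'n::{finite,linorder}) set set" where
  "turning_ridges S =
     {R. ridge S R \<and>
        (\<exists>F F' f f'. facet S F \<and> supports S f F \<and> first f < 0 \<and>
                     facet S F' \<and> supports S f' F' \<and> first f' > 0 \<and> R = F \<inter> F')}"


section \<open>The matrix \<open>\<I>\<^sup>+\<close>\<close>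

text \<open>
  Matrices are functions of a row and a column index, both starting at 1; \<open>dm\<close> stands for the
  coefficient \<open>d\<^sub>m\<close>. The polytope whose vertices, facets and ridges enter is
  \<open>{x \<in> S\<^sub>k. \<bar>C x - z\<^sub>k\<bar> \<le> 1}\<close>, not \<open>S\<^sub>k\<close>. The two coincide unless \<open>z\<^sub>k\<close> excludes some states of \<open>S\<^sub>k\<close>;
  if it does, the vertices and facets of \<open>S\<^sub>k\<close> do not determine \<open>S\<^sub>k\<^sub>+\<^sub>1\<close>. For instance, with \<open>m = 1\<close>,
  \<open>n\<^sub>1 = 10\<close>, \<open>d\<^sub>1 = 1\<close>, \<open>x\<^sub>0 = 0\<close> and \<open>z\<^sub>0 = z\<^sub>1 = 0\<close>, \<open>S\<^sub>1 = [-1, 1]\<close> and \<open>S\<^sub>2 = [-1.1, 1.1]\<close>, whereas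
  the matrix built from \<open>S\<^sub>1\<close> points to the vertices \<open>-2\<close> and \<open>2\<close>.
\<close>

definition inc_T ::
    "real \<Rightarrow> (nat \<Rightarrow> real ^ 'n::{finite,linorder}) \<Rightarrow> (nat \<Rightarrow> nat \<Rightarrow> nat) \<Rightarrow> nat \<Rightarrow> nat \<Rightarrow> nat" where
  "inc_T dm f M i j = (if M i j = 1 \<and> dm * first (f i) < 0 then 1 else 0)"

definition inc_B ::
    "real \<Rightarrow> (nat \<Rightarrow> real ^ 'n::{finite,linorder}) \<Rightarrow> (nat \<Rightarrow> nat \<Rightarrow> nat) \<Rightarrow> nat \<Rightarrow> nat \<Rightarrow> nat" where
  "inc_B dm f M i j = (if M i j = 1 \<and> dm * first (f i) > 0 then 1 else 0)"

text \<open>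
  \<open>nonzero_col nf M\<close> marks the columns of \<open>M\<close> that are not identically zero. It gives the vectors
  \<open>\<I>V\<^sup>P\<^sup>T\<close> and \<open>\<I>V\<^sup>P\<^sup>B\<close>, which are the argument \<open>V\<close> of \<open>inc_O\<close> and \<open>inc_R\<close>.
\<close>

definition nonzero_col :: "nat \<Rightarrow> (nat \<Rightarrow> nat \<Rightarrow> nat) \<Rightarrow> nat \<Rightarrow> nat" where
  "nonzero_col nf M j = (if \<exists>i\<in>{1..nf}. M i j \<noteq> 0 then 1 else 0)"

definition inc_O ::
    "(nat \<Rightarrow> real ^ 'n::{finite,linorder}) \<Rightarrow> (nat \<Rightarrow> nat \<Rightarrow> nat) \<Rightarrow> (nat \<Rightarrow> nat) \<Rightarrow> nat \<Rightarrow> nat \<Rightarrow> nat" where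
  "inc_O f M V i j = (if first (f i) = 0 \<and> V j = 1 \<and> M i j = 1 then 1 else 0)"

definition inc_R ::
    "(nat \<Rightarrow> 'a set) \<Rightarrow> (nat \<Rightarrow> 'a) \<Rightarrow> (nat \<Rightarrow> nat) \<Rightarrow> nat \<Rightarrow> nat \<Rightarrow> nat" where
  "inc_R R v V l j = (if v j \<in> R l \<and> V j = 1 then 1 else 0)"

definition inc_plus ::
    "real \<Rightarrow> nat \<Rightarrow> nat \<Rightarrow> (nat \<Rightarrow> nat \<Rightarrow> nat) \<Rightarrow> (nat \<Rightarrow> real ^ 'n::{finite,linorder}) \<Rightarrow>
     (nat \<Rightarrow> real ^ 'n::{finite,linorder}) \<Rightarrow> (nat \<Rightarrow> (real ^ 'n::{finite,linorder}) set) \<Rightarrow> nat \<Rightarrow> nat \<Rightarrow> nat" where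
  "inc_plus dm nf nv M v f R r c =
     (let MT = inc_T dm f M; MB = inc_B dm f M;
          VT = nonzero_col nf MT; VB = nonzero_col nf MB
      in if r \<le> nf then (if c \<le> nv then MT r c else 0)
         else if r \<le> 2 * nf then (if c \<le> nv then 0 else MB (r - nf) (c - nv))
         else if r \<le> 3 * nf then
           (if c \<le> nv then inc_O f M VT (r - 2 * nf) c else inc_O f M VB (r - 2 * nf) (c - nv))
         else
           (if c \<le> nv then inc_R R v VT (r - 3 * nf) c else inc_R R v VB (r - 3 * nf) (c - nv)))"

definition col_state ::
    "real poly \<Rightarrow> nat \<Rightarrow> (nat \<Rightarrow> real ^ 'n::{finite,linorder}) \<Rightarrow> nat \<Rightarrow> real ^ 'n::{finite,linorder}" where
  "col_state den nv v c =
     (if c \<le> nv then plant_A den *v v c + plant_B else plant_A den *v v (c - nv) - plant_B)"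

definition row_direction ::
    "real poly \<Rightarrow> nat \<Rightarrow> (nat \<Rightarrow> real ^ 'n::{finite,linorder}) \<Rightarrow> (nat \<Rightarrow> real ^ 'n::{finite,linorder}) \<Rightarrow> nat \<Rightarrow> real ^ 'n::{finite,linorder}"
  where
  "row_direction den nf f fR r =
     dual_A den *v
       (if r \<le> nf then f r
        else if r \<le> 2 * nf then f (r - nf)
        else if r \<le> 3 * nf then f (r - 2 * nf)
        else fR (r - 3 * nf))"

text \<open>The rows (columns) of an \<open>a \<times> b\<close> matrix that remain when the zero ones are removed.\<close>

definition nonzero_rows :: "nat \<Rightarrow> nat \<Rightarrow> (nat \<Rightarrow> nat \<Rightarrow> nat) \<Rightarrow> nat set" where
  "nonzero_rows a b M = {r \<in> {1..a}. \<exists>c\<in>{1..b}. M r c \<noteq> 0}"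

definition nonzero_cols :: "nat \<Rightarrow> nat \<Rightarrow> (nat \<Rightarrow> nat \<Rightarrow> nat) \<Rightarrow> nat set" where
  "nonzero_cols a b M = {c \<in> {1..b}. \<exists>r\<in>{1..a}. M r c \<noteq> 0}"

end

(*
  Since d_m is nonzero, A is invertible, the dual matrix is the inverse transpose of A, and A maps
  b = - e_1 / d_m to B. So the new uncertainty set is the image under A of the Minkowski sum of the
  current polytope with the segment [-b, b], and the dual matrix carries facet directions along. For
  the sum, a supporting face in direction f is translated by b or -b according to the sign of
  f . b = - f_1 / d_m, and is swept along the whole segment if f . b = 0. Hence the facets of the sum
  are the lifted facets together with the sweeps of those ridges at which f . b changes sign, and the
  vertices are the v + b (v - b) for which some facet through v has f . b > 0 (f . b < 0).
*)

theory Submission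
  imports Defs
begin

section \<open>Supporting faces of full-dimensional polytopes\<close>

text \<open>The sign of \<open>f \<bullet> b\<close> must be readable off whichever normal is listed
  for a facet. Full dimension ensures this: a facet then has a single outward normal up to a
  positive factor. A ridge has many normals, and only a tangential one yields a facet of the sum,
  which is why a special direction enters for ridges. The converse inclusions rest on one tool: if
  no positive step from \<open>x\<close> along \<open>y\<close> stays in \<open>P\<close>, some
  facet through \<open>x\<close> has a normal \<open>f\<close> with
  \<open>f \<bullet> y > 0\<close>. It supplies the two facets around a ridge, and the facet that
  witnesses in which direction a vertex is lifted. An incidence matrix repeats no row or column,
  whereas the block matrix lists every facet three times and every vertex twice. Exactly one of the
  three copies of a facet is non-zero. A vertex may give two vertices of the sum, so columns
  enumerate pairs of a vertex and a sign, and distinct admissible pairs are shown to give distinct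
  points.\<close>

lemma supports_iff:
  "supports S f F \<longleftrightarrow> f \<noteq> 0 \<and> (\<exists>p\<in>S. (\<forall>y\<in>S. f \<bullet> y \<le> f \<bullet> p) \<and> F = {y \<in> S. f \<bullet> y = f \<bullet> p})"
  unfolding supports_def by fastforce

text \<open>Once a contact point is known, the offset of the hyperplane has to be the value there,
  so the existential quantifier disappears.\<close>

lemma supports_at:
  "x \<in> F \<Longrightarrow>
    supports S f F \<longleftrightarrow> f \<noteq> 0 \<and> x \<in> S \<and> (\<forall>y\<in>S. f \<bullet> y \<le> f \<bullet> x) \<and> F = {y \<in> S. f \<bullet> y = f \<bullet> x}"
  unfolding supports_iff by fastforce

lemma supports_nonempty: "supports S f F \<Longrightarrow> F \<noteq> {}"
  by (simp add: supports_def)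

lemma supports_subset: "supports S f F \<Longrightarrow> F \<subseteq> S"
  by (auto simp: supports_def)

lemma supports_unique: "supports S f F \<Longrightarrow> supports S f G \<Longrightarrow> F = G"
  unfolding supports_iff by (metis (no_types, lifting) Collect_cong order_antisym)

lemma supports_scale_iff:
  assumes "c > 0"
  shows "supports S (c *\<^sub>R f) F \<longleftrightarrow> supports S f F"
  using assms unfolding supports_iff by auto

lemma supports_exists:
  assumes "compact S" "S \<noteq> {}" "f \<noteq> 0"
  obtains F where "supports S f F"
proof -
  have "continuous_on S ((\<bullet>) f)" by (intro continuous_intros)
  then obtain p where "p \<in> S" "\<forall>y\<in>S. f \<bullet> y \<le> f \<bullet> p"
    using continuous_attains_sup[OF assms(1,2)] by blast
  with assms(3) that show thesis unfolding supports_iff by blast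
qed

lemma supports_imp_face_of:
  assumes "convex S" "supports S f F"
  shows "F face_of S"
  using assms unfolding supports_def by (auto intro!: face_of_Int_supporting_hyperplane_le)

text \<open>At a common contact point both functionals are maximal, so elsewhere neither can make up
  for a deficit of the other. This later tilts the normal of a vertex and combines the two normals
  at a ridge.\<close>

lemma supports_add:
  assumes f: "supports S f F" and g: "supports S g G" and x: "x \<in> F" "x \<in> G"
    and c: "c > 0" and nz: "f + c *\<^sub>R g \<noteq> 0"
  shows "supports S (f + c *\<^sub>R g) (F \<inter> G)"
proof -
  note f' = f[unfolded supports_at[OF x(1)]] and g' = g[unfolded supports_at[OF x(2)]]
  have eq: "f \<bullet> y = f \<bullet> x \<and> g \<bullet> y = g \<bullet> x"
    if "y \<in> S" "f \<bullet> y + c * (g \<bullet> y) = f \<bullet> x + c * (g \<bullet> x)" for y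
  proof -
    have "f \<bullet> y \<le> f \<bullet> x" "c * (g \<bullet> y) \<le> c * (g \<bullet> x)"
      using f' g' that c by auto
    then have "f \<bullet> y = f \<bullet> x" "c * (g \<bullet> y) = c * (g \<bullet> x)" using that by linarith+
    then show ?thesis using c by simp
  qed
  have "F \<inter> G = {y \<in> S. (f + c *\<^sub>R g) \<bullet> y = (f + c *\<^sub>R g) \<bullet> x}" (is "_ = ?H")
  proof (intro equalityI subsetI)
    fix y assume "y \<in> F \<inter> G"
    then have "y \<in> S" "f \<bullet> y = f \<bullet> x" "g \<bullet> y = g \<bullet> x" using f' g' by blast+
    then show "y \<in> ?H" by (simp add: inner_add_left)
  next
    fix y assume "y \<in> ?H"
    then have y: "y \<in> S" "f \<bullet> y + c * (g \<bullet> y) = f \<bullet> x + c * (g \<bullet> x)"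
      by (simp_all add: inner_add_left)
    from eq[OF this] y(1) show "y \<in> F \<inter> G" using f' g' by blast
  qed
  moreover have "(f + c *\<^sub>R g) \<bullet> y \<le> (f + c *\<^sub>R g) \<bullet> x" if "y \<in> S" for y
    using f' g' that c by (auto simp: inner_add_left intro!: add_mono mult_left_mono)
  ultimately show ?thesis
    using nz f' x unfolding supports_at[OF IntI[OF x]] by blast
qed

text \<open>Both hyperplanes are the affine hull of \<open>F\<close>, so the normals are parallel; a
  point of \<open>S\<close> outside \<open>F\<close>, provided by full dimension, fixes the sign of
  the factor.\<close>

lemma facet_normal_unique:
  fixes S :: "'a::euclidean_space set"
  assumes full: "aff_dim S = DIM('a)" and "facet S F"
    and f: "supports S f F" and g: "supports S g F"
  obtains c where "c > 0" "g = c *\<^sub>R f"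
proof -
  have dim: "aff_dim F = int DIM('a) - 1" using \<open>facet S F\<close> by (simp add: facet_def)
  obtain x where x: "x \<in> F" using f supports_nonempty by blast
  note f' = f[unfolded supports_at[OF x]] and g' = g[unfolded supports_at[OF x]]
  have hull: "affine hull F = {y. h \<bullet> y = h \<bullet> x}" if "supports S h F" for h
  proof (rule affine_dim_equal)
    note h' = that[unfolded supports_at[OF x]]
    show "affine hull F \<subseteq> {y. h \<bullet> y = h \<bullet> x}"
      using h' by (intro hull_minimal affine_hyperplane) auto
    show "aff_dim (affine hull F) = aff_dim {y. h \<bullet> y = h \<bullet> x}"
      using h' dim by (simp add: of_nat_diff Suc_leI)
  qed (use x in \<open>auto simp: affine_hyperplane\<close>)
  then have eq: "f \<bullet> y = f \<bullet> x \<longleftrightarrow> g \<bullet> y = g \<bullet> x" for y using f g by blast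
  define c where "c = (g \<bullet> f) / (f \<bullet> f)"
  \<comment> \<open>\<open>h\<close> is the part of \<open>g\<close> orthogonal to \<open>f\<close>.
    Moving \<open>x\<close> by \<open>h\<close> stays in the hyperplane of \<open>f\<close>, hence
    in that of \<open>g\<close>, so \<open>h\<close> is orthogonal to \<open>g\<close> as well and
    vanishes.\<close>
  define h where "h = g - c *\<^sub>R f"
  have "f \<bullet> h = 0" using f' by (simp add: h_def c_def inner_diff_right inner_commute)
  moreover have "g \<bullet> h = 0" using eq[of "x + h"] \<open>f \<bullet> h = 0\<close> by (simp add: inner_add_right)
  ultimately have "h \<bullet> h = 0" by (simp add: h_def inner_diff_left)
  then have gc: "g = c *\<^sub>R f" by (simp add: h_def)
  have "F \<noteq> S" using dim full by auto
  then obtain a where a: "a \<in> S" "a \<notin> F" using supports_subset[OF f] by blast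
  then have "f \<bullet> a < f \<bullet> x" "g \<bullet> a < g \<bullet> x"
    using f' g' by (metis (mono_tags, lifting) mem_Collect_eq order_le_imp_less_or_eq)+
  then have "c > 0" unfolding gc by (smt (verit) inner_scaleR_left mult_less_cancel_left)
  then show thesis using gc that by blast
qed

text \<open>Facets of a polyhedron are exposed, so the two notions agree and results about
  \<open>facet_of\<close> become available.\<close>

lemma facet_iff_facet_of:
  fixes P :: "'a::euclidean_space set"
  assumes "polyhedron P" and full: "aff_dim P = DIM('a)"
  shows "facet P F \<longleftrightarrow> F facet_of P"
proof
  assume "facet P F"
  then obtain f where "supports P f F" "aff_dim F = int DIM('a) - 1"
    unfolding facet_def face_def by blast
  then show "F facet_of P"
    using assms supports_imp_face_of[of P f F] supports_nonempty polyhedron_imp_convex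
    by (auto simp: facet_of_def)
next
  assume F: "F facet_of P"
  then have "F \<noteq> {}" "aff_dim F = int DIM('a) - 1" using full by (auto simp: facet_of_def)
  moreover have "face P F"
    using facet_of_polyhedron[OF assms(1) F] \<open>F \<noteq> {}\<close>
    unfolding face_def supports_def by metis
  ultimately show "facet P F" unfolding facet_def by simp
qed

lemma vertex_iff_extreme_point:
  fixes P :: "'a::euclidean_space set"
  assumes "polyhedron P" and full: "aff_dim P = DIM('a)"
  shows "vertex P p \<longleftrightarrow> p extreme_point_of P"
proof
  assume "vertex P p"
  then show "p extreme_point_of P"
    using supports_imp_face_of polyhedron_imp_convex[OF assms(1)] face_of_singleton
    unfolding vertex_def face_def by blast
next
  assume "p extreme_point_of P"
  then have "{p} exposed_face_of P"
    using exposed_face_of_polyhedron[OF assms(1)] face_of_singleton by blast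
  then obtain a b where ab: "P \<subseteq> {x. a \<bullet> x \<le> b}" "{p} = P \<inter> {x. a \<bullet> x = b}"
    unfolding exposed_face_of_def by blast
  \<comment> \<open>A zero normal would expose all of \<open>P\<close>, which would then be a single
    point and not full-dimensional.\<close>
  have "a \<noteq> 0"
  proof
    assume "a = 0"
    then have "P = {p}" using ab by (auto split: if_splits)
    then show False using full by simp
  qed
  then show "vertex P p" using ab unfolding vertex_def face_def supports_def by blast
qed

lemma face_contains_vertex:
  fixes P :: "'a::euclidean_space set"
  assumes "polytope P" "aff_dim P = DIM('a)" "face P F"
  obtains p where "vertex P p" "p \<in> F"
proof -
  have F: "F face_of P" "F \<noteq> {}"
    using assms supports_imp_face_of polytope_imp_convex supports_nonempty
    unfolding face_def by blast+
  then have "compact F" "convex F"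
    using assms(1) face_of_imp_compact face_of_imp_convex polytope_imp_compact
      polytope_imp_convex by blast+
  then obtain p where "p extreme_point_of F"
    using F extreme_point_exists_convex by metis
  then show thesis
    using that extreme_point_of_face[OF F(1)] vertex_iff_extreme_point[of P p] assms
      polytope_imp_polyhedron by blast
qed

text \<open>The segment from an interior point \<open>a\<close> to \<open>y\<close> meets the
  frontier in some facet. The functional of that facet increases from \<open>a\<close> to the
  crossing point and, being linear, keeps increasing up to \<open>y\<close>.\<close>

lemma facet_separates:
  fixes P :: "'a::euclidean_space set"
  assumes P: "polyhedron P" and full: "aff_dim P = DIM('a)" and y: "y \<notin> P"
  obtains F f where "facet P F" "supports P f F" "\<And>x. x \<in> F \<Longrightarrow> f \<bullet> x < f \<bullet> y"
proof -
  have cl: "closed P" and cv: "convex P"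
    using P polyhedron_imp_closed polyhedron_imp_convex by auto
  have ri: "rel_interior P = interior P" using full by (rule interior_rel_interior)
  have "P \<noteq> {}" using full by auto
  then obtain a where a: "a \<in> interior P" using cv ri rel_interior_eq_empty by blast
  then have aP: "a \<in> P" using interior_subset by blast
  have "closed_segment a y \<inter> frontier P \<noteq> {}"
    using aP y by (intro connected_Int_frontier) auto
  then obtain p where p: "p \<in> closed_segment a y" "p \<in> frontier P" by blast
  then have "p \<in> rel_frontier P"
    using ri cl by (simp add: rel_frontier_def frontier_def)
  then obtain F where F: "F facet_of P" "p \<in> F"
    using rel_frontier_of_polyhedron[OF P] by auto
  then have fF: "facet P F" using facet_iff_facet_of[OF P full] by blast
  then obtain f where f: "supports P f F" unfolding facet_def face_def by blast
  note f' = f[unfolded supports_at[OF F(2)]]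
  have "a \<notin> F"
    using F(1) a ri face_of_disjoint_rel_interior[of F P]
    by (metis disjoint_iff facet_of_def facet_of_irrefl)
  then have lt: "f \<bullet> a < f \<bullet> p" using f' aP by (metis (mono_tags, lifting) mem_Collect_eq order_le_imp_less_or_eq)
  obtain u where u: "0 \<le> u" "u \<le> 1" "p = (1 - u) *\<^sub>R a + u *\<^sub>R y"
    using p(1) by (auto simp: in_segment)
  have "u \<noteq> 1" using u(3) y f' by auto
  have "f \<bullet> p = f \<bullet> a + u * (f \<bullet> y - f \<bullet> a)" by (simp add: u(3) inner_add_right algebra_simps)
  moreover have "u \<noteq> 0" using calculation lt by auto
  ultimately have "f \<bullet> p < f \<bullet> y"
    using lt u(1,2) \<open>u \<noteq> 1\<close> by (smt (verit) mult_less_cancel_right2 zero_less_mult_pos)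
  then have "f \<bullet> x < f \<bullet> y" if "x \<in> F" for x using f' that by auto
  then show thesis using that fF f by blast
qed

text \<open>Used in place of Farkas' lemma on normal cones.\<close>

lemma feasible_direction:
  fixes P :: "'a::euclidean_space set"
  assumes P: "polytope P" and full: "aff_dim P = DIM('a)" and x: "x \<in> P"
    and y: "\<And>F f. facet P F \<Longrightarrow> supports P f F \<Longrightarrow> x \<in> F \<Longrightarrow> f \<bullet> y \<le> 0"
  obtains e where "e > 0" "x + e *\<^sub>R y \<in> P"
proof -
  have ph: "polyhedron P" using P by (rule polytope_imp_polyhedron)
  let ?N = "{F. facet P F}"
  have fin: "finite ?N"
    using finite_polytope_facets[OF P] facet_iff_facet_of[OF ph full] by simp
  have "\<forall>F\<in>?N. \<exists>f. supports P f F" unfolding facet_def face_def by blast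
  then obtain n where n: "\<And>F. facet P F \<Longrightarrow> supports P (n F) F" by (metis mem_Collect_eq)
  \<comment> \<open>Facets through \<open>x\<close> tolerate every positive step, since their
    normals do not increase along \<open>y\<close>; the others have slack and tolerate short steps
    by continuity. There are finitely many, so one step length serves all.\<close>
  have "\<forall>F\<in>?N. eventually (\<lambda>e. \<forall>p\<in>F. n F \<bullet> (x + e *\<^sub>R y) \<le> n F \<bullet> p) (at_right 0)"
  proof
    fix F assume "F \<in> ?N"
    then have fF: "facet P F" and nF: "supports P (n F) F" using n by auto
    then obtain p where p: "p \<in> F" using supports_nonempty by blast
    note nF' = nF[unfolded supports_at[OF p]]
    have "eventually (\<lambda>e. n F \<bullet> (x + e *\<^sub>R y) \<le> n F \<bullet> p) (at_right 0)"
    proof (cases "x \<in> F")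
      case True
      then have "n F \<bullet> x = n F \<bullet> p" "n F \<bullet> y \<le> 0" using nF' y[OF fF nF] by auto
      then have "e > 0 \<Longrightarrow> n F \<bullet> (x + e *\<^sub>R y) \<le> n F \<bullet> p" for e
        by (simp add: inner_add_right mult_nonneg_nonpos)
      then show ?thesis using eventually_at_right_less by (rule eventually_mono[rotated])
    next
      case False
      then have lt: "n F \<bullet> (x + 0 *\<^sub>R y) < n F \<bullet> p" using nF' x by force
      have "((\<lambda>e. n F \<bullet> (x + e *\<^sub>R y)) \<longlongrightarrow> n F \<bullet> (x + 0 *\<^sub>R y)) (at_right 0)"
        by (intro tendsto_intros)
      from order_tendstoD(2)[OF this lt] show ?thesis
        by (rule eventually_mono) simp
    qed
    then show "eventually (\<lambda>e. \<forall>p\<in>F. n F \<bullet> (x + e *\<^sub>R y) \<le> n F \<bullet> p) (at_right 0)"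
    proof (rule eventually_mono)
      fix e assume e: "n F \<bullet> (x + e *\<^sub>R y) \<le> n F \<bullet> p"
      have "n F \<bullet> q = n F \<bullet> p" if "q \<in> F" for q using that nF' by blast
      with e show "\<forall>p\<in>F. n F \<bullet> (x + e *\<^sub>R y) \<le> n F \<bullet> p" by simp
    qed
  qed
  then have "eventually (\<lambda>e. \<forall>F\<in>?N. \<forall>p\<in>F. n F \<bullet> (x + e *\<^sub>R y) \<le> n F \<bullet> p) (at_right 0)"
    by (rule eventually_ball_finite[OF fin])
  then have "eventually (\<lambda>e. e > 0 \<and> (\<forall>F\<in>?N. \<forall>p\<in>F. n F \<bullet> (x + e *\<^sub>R y) \<le> n F \<bullet> p)) (at_right 0)"
    using eventually_at_right_less eventually_conj by blast
  then obtain e where e: "e > 0" "\<forall>F\<in>?N. \<forall>p\<in>F. n F \<bullet> (x + e *\<^sub>R y) \<le> n F \<bullet> p"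
    using eventually_happens'[OF trivial_limit_at_right_real] by blast
  \<comment> \<open>A point outside \<open>P\<close> would violate a facet inequality; the violated
    normal is a positive multiple of the chosen \<open>n F\<close>.\<close>
  have "x + e *\<^sub>R y \<in> P"
  proof (rule ccontr)
    assume "x + e *\<^sub>R y \<notin> P"
    then obtain F f where F: "facet P F" "supports P f F" and lt: "\<And>q. q \<in> F \<Longrightarrow> f \<bullet> q < f \<bullet> (x + e *\<^sub>R y)"
      using facet_separates[OF ph full] by metis
    obtain c where "c > 0" "f = c *\<^sub>R n F"
      using facet_normal_unique[OF full F(1) n[OF F(1)] F(2)] by blast
    moreover obtain q where "q \<in> F" using F(2) supports_nonempty by blast
    ultimately show False using lt[of q] e(2) F(1) by (simp add: not_less[symmetric])
  qed
  with e(1) that show thesis by blast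
qed

text \<open>Contrapositive of \<open>feasible_direction\<close>: leaving \<open>P\<close> at once
  along \<open>y\<close> is charged to a facet with a known sign on \<open>y\<close>.\<close>

lemma blocking_facet:
  fixes P :: "'a::euclidean_space set"
  assumes P: "polytope P" and full: "aff_dim P = DIM('a)" and x: "x \<in> P"
    and infeasible: "\<And>e. e > 0 \<Longrightarrow> x + e *\<^sub>R y \<notin> P"
  obtains F f where "facet P F" "supports P f F" "x \<in> F" "f \<bullet> y > 0"
proof (rule ccontr)
  assume "\<not> thesis"
  with that have "f \<bullet> y \<le> 0" if "facet P F" "supports P f F" "x \<in> F" for f F
    using that by (meson not_less)
  then show False using feasible_direction[OF P full x, of y] infeasible by blast
qed

section \<open>Minkowski sum of a polytope and a segment\<close>

definition prism :: "'a::euclidean_space \<Rightarrow> 'a set \<Rightarrow> 'a set" where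
  "prism b P = {x + u *\<^sub>R b | x u. x \<in> P \<and> \<bar>u\<bar> \<le> 1}"

text \<open>
  The equation on \<open>u\<close> forces \<open>u = 1\<close> if \<open>g \<bullet> b > 0\<close> and \<open>u = - 1\<close> if \<open>g \<bullet> b < 0\<close>, and is void if
  \<open>g \<bullet> b = 0\<close>.
\<close>

definition lift :: "'a::euclidean_space \<Rightarrow> 'a \<Rightarrow> 'a set \<Rightarrow> 'a set" where
  "lift b g G = {x + u *\<^sub>R b | x u. x \<in> G \<and> \<bar>u\<bar> \<le> 1 \<and> u * (g \<bullet> b) = \<bar>g \<bullet> b\<bar>}"

lemma prismI: "x \<in> P \<Longrightarrow> \<bar>u\<bar> \<le> 1 \<Longrightarrow> x + u *\<^sub>R b \<in> prism b P"
  unfolding prism_def by blast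

lemma subset_prism: "P \<subseteq> prism b P"
  using prismI[of _ P 0 b] by auto

lemma aff_dim_prism:
  fixes P :: "'a::euclidean_space set"
  assumes "aff_dim P = DIM('a)"
  shows "aff_dim (prism b P) = DIM('a)"
  using assms aff_dim_subset[OF subset_prism, of P b] aff_dim_le_DIM[of "prism b P"] by simp

text \<open>On \<open>x + u *\<^sub>R b\<close> the functional splits into
  \<open>g \<bullet> x\<close> and \<open>u * (g \<bullet> b)\<close>, which are maximised
  independently; a maximal total forces both to be maximal.\<close>

lemma supports_lift:
  assumes "supports P g G"
  shows "supports (prism b P) g (lift b g G)"
proof -
  obtain p where p: "p \<in> G" using assms supports_nonempty by blast
  note G = assms[unfolded supports_at[OF p]]
  \<comment> \<open>An end of the segment at which \<open>u * (g \<bullet> b)\<close> attains its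
    maximum \<open>\<bar>g \<bullet> b\<bar>\<close>; for a tangential \<open>g\<close> either end
    would do.\<close>
  define s where "s = (if g \<bullet> b < 0 then -1 else 1 :: real)"
  have s: "\<bar>s\<bar> \<le> 1" "s * (g \<bullet> b) = \<bar>g \<bullet> b\<bar>" by (auto simp: s_def)
  let ?q = "p + s *\<^sub>R b"
  have q: "?q \<in> lift b g G" unfolding lift_def using p s by blast
  have gq: "g \<bullet> ?q = g \<bullet> p + \<bar>g \<bullet> b\<bar>" by (simp add: inner_add_right s)
  have le: "u * (g \<bullet> b) \<le> \<bar>g \<bullet> b\<bar>" if "\<bar>u\<bar> \<le> 1" for u
    using that mult_left_le_one_le[of "\<bar>g \<bullet> b\<bar>" "\<bar>u\<bar>"]
    by (metis abs_ge_self abs_ge_zero abs_mult order_trans)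
  have "g \<bullet> y \<le> g \<bullet> ?q" if "y \<in> prism b P" for y
    using that le G unfolding gq prism_def by (auto simp: inner_add_right intro!: add_mono)
  moreover have "lift b g G = {y \<in> prism b P. g \<bullet> y = g \<bullet> ?q}"
  proof (intro equalityI subsetI)
    fix y assume "y \<in> lift b g G"
    then obtain x u where xu: "x \<in> G" "\<bar>u\<bar> \<le> 1" "u * (g \<bullet> b) = \<bar>g \<bullet> b\<bar>" "y = x + u *\<^sub>R b"
      unfolding lift_def by blast
    then have "x \<in> P" "g \<bullet> x = g \<bullet> p" using G by blast+
    then show "y \<in> {y \<in> prism b P. g \<bullet> y = g \<bullet> ?q}"
      unfolding gq prism_def using xu by (auto simp: inner_add_right)
  next
    fix y assume y: "y \<in> {y \<in> prism b P. g \<bullet> y = g \<bullet> ?q}"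
    then obtain x u where xu: "x \<in> P" "\<bar>u\<bar> \<le> 1" "y = x + u *\<^sub>R b"
      unfolding prism_def by blast
    have "g \<bullet> x + u * (g \<bullet> b) = g \<bullet> p + \<bar>g \<bullet> b\<bar>"
      using y xu(3) unfolding gq by (simp add: inner_add_right)
    moreover have "g \<bullet> x \<le> g \<bullet> p" using G xu(1) by blast
    ultimately have "g \<bullet> x = g \<bullet> p" "u * (g \<bullet> b) = \<bar>g \<bullet> b\<bar>" using le[OF xu(2)] by linarith+
    then show "y \<in> lift b g G" unfolding lift_def using xu G by blast
  qed
  moreover have "?q \<in> prism b P" unfolding prism_def using G s(1) by blast
  ultimately show ?thesis unfolding supports_at[OF q] using G by blast
qed

text \<open>Compactness gives a face of \<open>P\<close> in the same direction \<open>g\<close>, and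
  a direction determines its face.\<close>

lemma supports_prismE:
  assumes "compact P" and H: "supports (prism b P) g H"
  obtains G where "supports P g G" "H = lift b g G"
proof -
  have "g \<noteq> 0" "P \<noteq> {}" using H unfolding supports_iff prism_def by auto
  then obtain G where "supports P g G" using supports_exists assms(1) by blast
  then show thesis using that supports_lift supports_unique[OF H] by blast
qed

lemma lift_transversal:
  assumes "g \<bullet> b \<noteq> 0"
  shows "lift b g G = (+) (sgn (g \<bullet> b) *\<^sub>R b) ` G"
proof -
  have "\<bar>u\<bar> \<le> 1 \<and> u * (g \<bullet> b) = \<bar>g \<bullet> b\<bar> \<longleftrightarrow> u = sgn (g \<bullet> b)" for u :: real
  proof -
    have "\<bar>g \<bullet> b\<bar> = sgn (g \<bullet> b) * (g \<bullet> b)" by (simp add: abs_sgn mult.commute)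
    then show ?thesis using assms by (auto simp: abs_sgn_eq)
  qed
  then show ?thesis unfolding lift_def by (auto simp: add.commute)
qed

lemma lift_tangential: "g \<bullet> b = 0 \<Longrightarrow> lift b g G = prism b G"
  unfolding lift_def prism_def by simp

lemma lift_scale: "c > 0 \<Longrightarrow> lift b (c *\<^sub>R g) G = lift b g G"
  unfolding lift_def by (simp add: abs_mult mult.left_commute[of _ c])

text \<open>The affine hull of \<open>G\<close> with \<open>x + b\<close> added is closed under
  adding multiples of \<open>(x + b) - x\<close>, so it contains the whole sweep. The dimension thus
  rises by one exactly if \<open>x + b\<close> lies outside the affine hull of
  \<open>G\<close>.\<close>

lemma aff_dim_prism_insert:
  assumes x: "x \<in> G"
  shows "aff_dim (prism b G) = aff_dim (insert (x + b) G)"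
proof (rule antisym)
  let ?A = "affine hull insert (x + b) G"
  have "y + u *\<^sub>R b \<in> ?A" if "y \<in> G" for y u
  proof -
    have in_hull: "y \<in> ?A" "x + b \<in> ?A" "x \<in> ?A" using x that by (auto intro: hull_inc)
    have "(y + u *\<^sub>R ((x + b) - x)) \<in> ?A"
      using mem_affine_3_minus[OF affine_affine_hull in_hull] .
    then show ?thesis by simp
  qed
  then have "prism b G \<subseteq> ?A" unfolding prism_def by blast
  then show "aff_dim (prism b G) \<le> aff_dim (insert (x + b) G)"
    using aff_dim_subset[of "prism b G" ?A] by simp
  have "x + b \<in> prism b G" using prismI[OF x, of 1 b] by simp
  then show "aff_dim (insert (x + b) G) \<le> aff_dim (prism b G)"
    using subset_prism by (intro aff_dim_subset) auto
qed

section \<open>Facets of the Minkowski sum with a segment\<close>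

lemma supports_aff_dim_le:
  fixes S :: "'a::euclidean_space set"
  assumes "supports S g H"
  shows "aff_dim H \<le> int DIM('a) - 1"
proof -
  obtain c where "g \<noteq> 0" "H \<subseteq> {x. g \<bullet> x = c}" using assms unfolding supports_def by blast
  then show ?thesis
    using aff_dim_subset[of H "{x. g \<bullet> x = c}"] by (simp add: of_nat_diff Suc_leI)
qed

text \<open>Lifting does not lower the dimension, and no supporting face has dimension above
  \<open>DIM('a) - 1\<close>.\<close>

lemma facet_lift:
  assumes "facet P G" and g: "supports P g G"
  shows "facet (prism b P) (lift b g G)"
proof -
  have "aff_dim (lift b g G) \<ge> aff_dim G"
  proof (cases "g \<bullet> b = 0")
    case True
    then show ?thesis using aff_dim_subset[OF subset_prism] by (simp add: lift_tangential)
  next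
    case False
    then show ?thesis by (simp add: lift_transversal aff_dim_translation_eq)
  qed
  then show ?thesis
    using supports_lift[OF g] supports_aff_dim_le assms(1) unfolding facet_def face_def
    by (metis order_antisym)
qed

text \<open>The ridges along which the direction \<open>b\<close> is tangent to \<open>S\<close>.\<close>

definition shadow_ridges :: "'a::euclidean_space \<Rightarrow> 'a set \<Rightarrow> 'a set set" where
  "shadow_ridges b S = {R. ridge S R \<and>
     (\<exists>F F' f f'. facet S F \<and> supports S f F \<and> f \<bullet> b < 0 \<and>
                  facet S F' \<and> supports S f' F' \<and> f' \<bullet> b > 0 \<and> R = F \<inter> F')}"

text \<open>\<open>f\<close> is constant on \<open>R\<close> but not along \<open>b\<close>, so
  \<open>b\<close> points out of the affine hull of \<open>R\<close> and the sweep gains the one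
  missing dimension.\<close>

lemma facet_lift_ridge:
  assumes R: "R \<in> shadow_ridges b P" and g: "supports P g R" "g \<bullet> b = 0"
  shows "facet (prism b P) (lift b g R)"
proof -
  obtain F f where f: "supports P f F" "f \<bullet> b < 0" "R \<subseteq> F" and R: "ridge P R"
    using R unfolding shadow_ridges_def by blast
  obtain x where x: "x \<in> R" using g supports_nonempty by blast
  then have "x \<in> F" using f by blast
  note f' = f(1)[unfolded supports_at[OF this]]
  have "affine hull R \<subseteq> {y. f \<bullet> y = f \<bullet> x}"
    using f' f(3) by (intro hull_minimal affine_hyperplane) auto
  then have "x + b \<notin> affine hull R" using f(2) by (auto simp: inner_add_right)
  then have "aff_dim (lift b g R) = aff_dim R + 1"
    using aff_dim_prism_insert[OF x, of b] by (simp add: lift_tangential g aff_dim_insert)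
  then show ?thesis
    using R supports_lift[OF g(1)] unfolding ridge_def facet_def face_def by auto
qed

text \<open>If \<open>G\<close> is not a facet, its lift must gain a dimension, which forces
  \<open>g \<bullet> b = 0\<close> and codimension two. From a relative interior point of
  \<open>G\<close> both \<open>b\<close> and \<open>- b\<close> then leave \<open>P\<close> at once,
  and the two blocking facets meet exactly in \<open>G\<close>.\<close>

lemma facet_prismE:
  fixes P :: "'a::euclidean_space set"
  assumes P: "polytope P" and full: "aff_dim P = DIM('a)"
    and H: "facet (prism b P) H" "supports (prism b P) g H"
  obtains G where "supports P g G" "H = lift b g G"
    "facet P G \<or> G \<in> shadow_ridges b P \<and> g \<bullet> b = 0"
proof -
  have cv: "convex P" and cp: "compact P"
    using P polytope_imp_convex polytope_imp_compact by auto
  obtain G where G: "supports P g G" and HG: "H = lift b g G"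
    using supports_prismE[OF cp H(2)] .
  have dimH: "aff_dim H = int DIM('a) - 1" using H(1) by (simp add: facet_def)
  have "G \<in> shadow_ridges b P \<and> g \<bullet> b = 0" if nf: "\<not> facet P G"
  proof -
    have dimG: "aff_dim G \<noteq> int DIM('a) - 1" using nf G unfolding facet_def face_def by blast
    \<comment> \<open>A transversal lift is a mere translate of \<open>G\<close>, whose dimension
      differs from that of \<open>H\<close>.\<close>
    have gb: "g \<bullet> b = 0"
      using dimG dimH HG lift_transversal[of g b G] aff_dim_translation_eq by metis
    have Gface: "G face_of P" using cv G by (rule supports_imp_face_of)
    then have "rel_interior G \<noteq> {}"
      using face_of_imp_convex[OF Gface] rel_interior_eq_empty supports_nonempty[OF G] by blast
    \<comment> \<open>The relative interior matters because every face of \<open>P\<close> through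
      such a point contains all of \<open>G\<close>.\<close>
    then obtain x where xr: "x \<in> rel_interior G" by blast
    then have x: "x \<in> G" using rel_interior_subset by blast
    note G' = G[unfolded supports_at[OF x]]
    have dimH': "aff_dim H = (if x + b \<in> affine hull G then aff_dim G else aff_dim G + 1)"
      using aff_dim_prism_insert[OF x, of b] by (simp add: HG lift_tangential gb aff_dim_insert)
    then have nx: "x + b \<notin> affine hull G" and dimG2: "aff_dim G = int DIM('a) - 2"
      using dimG dimH by (auto split: if_splits)
    \<comment> \<open>Since \<open>g \<bullet> b = 0\<close>, a step staying in \<open>P\<close>
      would stay in \<open>G\<close> and put \<open>x + b\<close> into its affine hull.\<close>
    have infeasible: "x + e *\<^sub>R b \<notin> P" if "e \<noteq> 0" for e
    proof
      assume "x + e *\<^sub>R b \<in> P"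
      then have "x + e *\<^sub>R b \<in> G" using G' gb by (simp add: inner_add_right)
      then have "x + (1 / e) *\<^sub>R ((x + e *\<^sub>R b) - x) \<in> affine hull G"
        using x by (intro mem_affine_3_minus affine_affine_hull hull_inc) auto
      then show False using nx that by simp
    qed
    obtain F f where F: "facet P F" "supports P f F" "x \<in> F" "f \<bullet> b < 0"
    proof (rule blocking_facet[OF P full, of x "- b"])
      show "x + e *\<^sub>R (- b) \<notin> P" if "e > 0" for e using infeasible[of "- e"] that by simp
    qed (use G' in auto)
    obtain F' f' where F': "facet P F'" "supports P f' F'" "x \<in> F'" "f' \<bullet> b > 0"
      using blocking_facet[OF P full, of x b] G' infeasible by (metis less_irrefl)
    have Ff: "F face_of P" "F' face_of P" using F F' cv supports_imp_face_of by blast+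
    have sub: "G \<subseteq> F \<inter> F'"
      using subset_of_face_of[OF Ff(1), of G] subset_of_face_of[OF Ff(2), of G] xr F F' G' by blast
    \<comment> \<open>A larger intersection would have the dimension of a facet, so \<open>F\<close>
      and \<open>F'\<close> would coincide, against the opposite signs of their normals on
      \<open>b\<close>.\<close>
    have "G = F \<inter> F'"
    proof (rule ccontr)
      assume "G \<noteq> F \<inter> F'"
      have I: "F \<inter> F' face_of P" using Ff by (rule face_of_Int)
      then have "G face_of F \<inter> F'" "convex (F \<inter> F')"
        using face_of_subset[OF Gface sub] face_of_imp_subset face_of_imp_convex cv by blast+
      then have "aff_dim G < aff_dim (F \<inter> F')" using face_of_aff_dim_lt \<open>G \<noteq> F \<inter> F'\<close> by blast
      then have d: "aff_dim (F \<inter> F') \<ge> int DIM('a) - 1" using dimG2 by simp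
      have "F \<inter> F' face_of F" "F \<inter> F' face_of F'" "convex F" "convex F'"
        using face_of_subset[OF I] Ff face_of_imp_subset face_of_imp_convex cv by auto
      then have "F \<inter> F' = F" "F \<inter> F' = F'"
        using face_of_aff_dim_lt d F(1) F'(1) unfolding facet_def by force+
      then have "F' = F" by simp
      then obtain c where "c > 0" "f' = c *\<^sub>R f"
        using facet_normal_unique[OF full F(1,2)] F'(2) by blast
      then show False using F(4) F'(4) by (simp add: zero_less_mult_iff)
    qed
    moreover have "ridge P G" using dimG2 G unfolding ridge_def face_def by blast
    ultimately show ?thesis using F F' gb unfolding shadow_ridges_def by blast
  qed
  then show thesis using that G HG by blast
qed

section \<open>Vertices of the Minkowski sum with a segment\<close>

lemma vertex_on_transversal_facet:
  fixes P :: "'a::euclidean_space set"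
  assumes P: "polytope P" and full: "aff_dim P = DIM('a)" and p: "vertex P p" and "b \<noteq> 0"
  obtains F f where "facet P F" "supports P f F" "p \<in> F" "f \<bullet> b \<noteq> 0"
proof -
  obtain g where g: "supports P g {p}" using p unfolding vertex_def face_def by blast
  then have pP: "p \<in> P" and max: "\<And>y. y \<in> P \<Longrightarrow> y \<noteq> p \<Longrightarrow> g \<bullet> y < g \<bullet> p"
    unfolding supports_at[OF singletonI] by (blast, fastforce)
  \<comment> \<open>\<open>t\<close> orients \<open>b\<close> so that \<open>g\<close> does not
    decrease. As \<open>p\<close> is the only maximiser of \<open>g\<close>, every step leaves
    \<open>P\<close>, and the blocking facet is transversal.\<close>
  define t where "t = (if g \<bullet> b \<ge> 0 then 1 else -1 :: real)"
  have "p + e *\<^sub>R (t *\<^sub>R b) \<notin> P" if "e > 0" for e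
    using max[of "p + e *\<^sub>R (t *\<^sub>R b)"] that \<open>b \<noteq> 0\<close>
    by (auto simp: t_def inner_add_right inner_diff_right mult_less_0_iff zero_less_mult_iff split: if_splits)
  then obtain F f where "facet P F" "supports P f F" "p \<in> F" "f \<bullet> (t *\<^sub>R b) > 0"
    using blocking_facet[OF P full pP] by metis
  then show thesis using that by (metis inner_scaleR_right less_irrefl mult_zero_right)
qed

text \<open>\<open>s\<close> is the end of the segment \<open>[- b, b]\<close> that is added to the vertex \<open>p\<close>.\<close>

definition lifted_vertices :: "'a::euclidean_space \<Rightarrow> 'a set \<Rightarrow> ('a \<times> real) set" where
  "lifted_vertices b P = {(p, s). vertex P p \<and> s \<in> {1, -1} \<and>
     (\<exists>F f. facet P F \<and> supports P f F \<and> p \<in> F \<and> s * (f \<bullet> b) > 0)}"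

lemma lift_vertex_normal:
  assumes "s \<in> {1, -1}" "s * (g \<bullet> b) > 0"
  shows "lift b g {p} = {p + s *\<^sub>R b}"
proof -
  have "sgn (g \<bullet> b) = s" "g \<bullet> b \<noteq> 0" using assms by (auto simp: sgn_real_def)
  then show ?thesis by (simp add: lift_transversal add.commute)
qed

text \<open>A normal exposing \<open>p\<close> may have the wrong sign on \<open>b\<close>. Adding a
  large multiple of \<open>f\<close> still exposes \<open>p\<close> alone and corrects the
  sign.\<close>

lemma vertex_prism:
  fixes P :: "'a::euclidean_space set"
  assumes ps: "(p, s) \<in> lifted_vertices b P"
  shows "vertex (prism b P) (p + s *\<^sub>R b)"
proof -
  obtain F f g where p: "supports P g {p}" and s: "s \<in> {1, -1}"
    and F: "supports P f F" "p \<in> F" "s * (f \<bullet> b) > 0"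
    using ps unfolding lifted_vertices_def vertex_def face_def by blast
  \<comment> \<open>Chosen so that \<open>f\<close> contributes
    \<open>1 + \<bar>g \<bullet> b\<bar>\<close>, which outweighs \<open>s * (g \<bullet> b)\<close>
    whatever its sign.\<close>
  define c where "c = (1 + \<bar>g \<bullet> b\<bar>) / (s * (f \<bullet> b))"
  have c: "c > 0" "c * (s * (f \<bullet> b)) = 1 + \<bar>g \<bullet> b\<bar>" using F(3) by (auto simp: c_def intro!: divide_pos_pos)
  have "s * ((g + c *\<^sub>R f) \<bullet> b) = s * (g \<bullet> b) + (1 + \<bar>g \<bullet> b\<bar>)"
    using c(2) by (simp add: inner_add_left algebra_simps)
  then have pos: "s * ((g + c *\<^sub>R f) \<bullet> b) > 0" using s by auto
  then have "supports P (g + c *\<^sub>R f) {p}"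
    using supports_add[OF p F(1) singletonI F(2) c(1)] F(2) by fastforce
  from supports_lift[OF this, of b] show ?thesis
    unfolding vertex_def face_def lift_vertex_normal[OF s pos] by blast
qed

lemma vertex_prismE:
  fixes P :: "'a::euclidean_space set"
  assumes P: "polytope P" and full: "aff_dim P = DIM('a)" and b: "b \<noteq> 0"
    and q: "vertex (prism b P) q"
  obtains p s where "(p, s) \<in> lifted_vertices b P" "q = p + s *\<^sub>R b"
proof -
  obtain g where "supports (prism b P) g {q}" using q unfolding vertex_def face_def by blast
  then obtain G where G: "supports P g G" and qG: "{q} = lift b g G"
    using supports_prismE P polytope_imp_compact by metis
  obtain p where p: "p \<in> G" using G supports_nonempty by blast
  \<comment> \<open>A tangential lift would contain both \<open>p\<close> and \<open>p + b\<close>,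
    hence more than one point.\<close>
  have gb: "g \<bullet> b \<noteq> 0"
  proof
    assume "g \<bullet> b = 0"
    then have "p + 1 *\<^sub>R b \<in> {q}" "p + 0 *\<^sub>R b \<in> {q}"
      unfolding qG by (auto simp only: lift_tangential intro!: prismI p)
    then show False using b by auto
  qed
  define s where "s = sgn (g \<bullet> b)"
  have s: "s \<in> {1, -1}" "s * (g \<bullet> b) > 0" using gb by (auto simp: s_def sgn_real_def)
  have eq: "{q} = (+) (s *\<^sub>R b) ` G" using qG lift_transversal[OF gb] by (simp add: s_def)
  have "x = p" if "x \<in> G" for x
    using eq that p by (metis add_left_cancel image_eqI singletonD)
  then have Gp: "G = {p}" using p by blast
  then have v: "vertex P p" using G unfolding vertex_def face_def by blast
  have p': "p \<in> P" "\<And>y. y \<in> P \<Longrightarrow> g \<bullet> y \<le> g \<bullet> p" using G[unfolded supports_at[OF p]] by blast+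
  \<comment> \<open>\<open>g\<close> would exceed its maximum on \<open>P\<close> there; the facet
    that blocks this step has the sign required by \<open>lifted_vertices\<close>.\<close>
  have "p + e *\<^sub>R (s *\<^sub>R b) \<notin> P" if "e > 0" for e
    using p'(2)[of "p + e *\<^sub>R (s *\<^sub>R b)"] mult_pos_pos[OF that s(2)]
    by (auto simp: inner_add_right)
  then obtain F f where "facet P F" "supports P f F" "p \<in> F" "f \<bullet> (s *\<^sub>R b) > 0"
    using blocking_facet[OF P full p'(1)] by metis
  then have "\<exists>F f. facet P F \<and> supports P f F \<and> p \<in> F \<and> s * (f \<bullet> b) > 0" by auto
  then have "(p, s) \<in> lifted_vertices b P" using v s(1) unfolding lifted_vertices_def by blast
  moreover have "q = p + s *\<^sub>R b" using eq Gp by (simp add: add.commute)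
  ultimately show thesis using that by blast
qed

text \<open>Only opposite signs could clash, and then \<open>p' = p + (2 * s) *\<^sub>R b\<close>;
  but the facet witnessing \<open>(p, s)\<close> bars every move from \<open>p\<close> in that
  direction.\<close>

lemma lifted_vertices_inj:
  assumes "(p, s) \<in> lifted_vertices b P" "(p', s') \<in> lifted_vertices b P"
    and eq: "p + s *\<^sub>R b = p' + s' *\<^sub>R b"
  shows "p = p' \<and> s = s'"
proof (cases "s = s'")
  case True
  then show ?thesis using eq by simp
next
  case False
  obtain F f where F: "supports P f F" "p \<in> F" "s * (f \<bullet> b) > 0" and s: "s \<in> {1, -1}"
    using assms(1) unfolding lifted_vertices_def by blast
  have "p' \<in> P" "s' \<in> {1, -1}"
    using assms(2) supports_subset unfolding lifted_vertices_def vertex_def face_def by blast+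
  then have "s' = - s" using s False by auto
  then have "p' = p + (2 * s) *\<^sub>R b" using eq by (simp add: algebra_simps flip: scaleR_2)
  then have "f \<bullet> p' > f \<bullet> p" using F(3) by (simp add: inner_add_right mult.assoc)
  then show ?thesis using F \<open>p' \<in> P\<close> supports_at[OF F(2)] by (meson not_less)
qed

text \<open>The index sets are arbitrary, so that the surviving rows and columns of the block matrix
  can be inserted. \<open>gb\<close> singles out a tangential normal among the many of a
  ridge.\<close>

theorem prism_incidence_matrix:
  fixes P :: "'a::euclidean_space set"
  assumes P: "polytope P" and full: "aff_dim P = DIM('a)" and b: "b \<noteq> 0"
    and rows: "bij_betw G I ({G. facet P G} \<union> shadow_ridges b P)"
    and g: "\<And>i. i \<in> I \<Longrightarrow> supports P (g i) (G i)"
    and gb: "\<And>i. i \<in> I \<Longrightarrow> G i \<in> shadow_ridges b P \<Longrightarrow> g i \<bullet> b = 0"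
    and cols: "bij_betw (\<lambda>j. (v j, s j)) J (lifted_vertices b P)"
  shows "incidence_matrix (prism b P) I J
           (\<lambda>i j. if v j + s j *\<^sub>R b \<in> lift b (g i) (G i) then 1 else 0)
           (\<lambda>j. v j + s j *\<^sub>R b) (\<lambda>i. lift b (g i) (G i)) g"
proof -
  note full' = aff_dim_prism[OF full, of b]
  have sup: "supports (prism b P) (g i) (lift b (g i) (G i))" if "i \<in> I" for i
    using supports_lift g that by blast
  have fac: "facet (prism b P) (lift b (g i) (G i))" if "i \<in> I" for i
    using bij_betwE[OF rows] g[OF that] gb[OF that] that facet_lift facet_lift_ridge
    by (metis UnE mem_Collect_eq)
  have "bij_betw (\<lambda>j. v j + s j *\<^sub>R b) J {p. vertex (prism b P) p}"
    unfolding bij_betw_def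
  proof (intro conjI inj_onI equalityI subsetI)
    fix i j assume ij: "i \<in> J" "j \<in> J" "v i + s i *\<^sub>R b = v j + s j *\<^sub>R b"
    then have "(v i, s i) \<in> lifted_vertices b P" "(v j, s j) \<in> lifted_vertices b P"
      using bij_betwE[OF cols] by blast+
    from lifted_vertices_inj[OF this ij(3)] show "i = j"
      using cols ij unfolding bij_betw_def inj_on_def by blast
  next
    fix q assume "q \<in> (\<lambda>j. v j + s j *\<^sub>R b) ` J"
    then show "q \<in> {p. vertex (prism b P) p}" using bij_betwE[OF cols] vertex_prism by blast
  next
    fix q assume "q \<in> {p. vertex (prism b P) p}"
    then obtain p t where "(p, t) \<in> lifted_vertices b P" and q: "q = p + t *\<^sub>R b"
      using vertex_prismE[OF P full b] by blast
    then have "(p, t) \<in> (\<lambda>j. (v j, s j)) ` J" using cols by (simp add: bij_betw_def)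
    then show "q \<in> (\<lambda>j. v j + s j *\<^sub>R b) ` J" using q by blast
  qed
  moreover have "bij_betw (\<lambda>i. lift b (g i) (G i)) I {H. facet (prism b P) H}"
    unfolding bij_betw_def
  proof (intro conjI inj_onI equalityI subsetI)
    fix i j assume ij: "i \<in> I" "j \<in> I" and eq: "lift b (g i) (G i) = lift b (g j) (G j)"
    \<comment> \<open>Equal lifts are one facet of the sum, so the two normals are proportional and
      expose the same face of \<open>P\<close>.\<close>
    obtain c where "c > 0" "g j = c *\<^sub>R g i"
      using facet_normal_unique[OF full' fac[OF ij(1)] sup[OF ij(1)]] sup[OF ij(2)]
      unfolding eq by blast
    then have "supports P (g i) (G j)" using g[OF ij(2)] supports_scale_iff by metis
    then have "G i = G j" using g[OF ij(1)] supports_unique by blast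
    then show "i = j" using rows ij unfolding bij_betw_def inj_on_def by blast
  next
    fix H assume "H \<in> (\<lambda>i. lift b (g i) (G i)) ` I"
    then show "H \<in> {H. facet (prism b P) H}" using fac by blast
  next
    fix H assume "H \<in> {H. facet (prism b P) H}"
    then obtain h where h: "facet (prism b P) H" "supports (prism b P) h H"
      unfolding facet_def face_def by blast
    obtain K where K: "supports P h K" "H = lift b h K"
      and cases: "facet P K \<or> K \<in> shadow_ridges b P \<and> h \<bullet> b = 0"
      using facet_prismE[OF P full h] .
    then obtain i where i: "i \<in> I" "K = G i" using rows unfolding bij_betw_def by blast
    \<comment> \<open>For a facet, \<open>h\<close> and \<open>g i\<close> are proportional; for a
      ridge both annihilate \<open>b\<close>, and the lift is the full sweep for either
      normal.\<close>
    have "lift b h K = lift b (g i) (G i)"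
    proof (cases "facet P K")
      case True
      then obtain c where "c > 0" "g i = c *\<^sub>R h"
        using facet_normal_unique[OF full True K(1)] g[OF i(1)] i(2) by blast
      then show ?thesis using i(2) lift_scale by metis
    next
      case False
      then show ?thesis using cases gb[OF i(1)] i(2) by (simp add: lift_tangential)
    qed
    then show "H \<in> (\<lambda>i. lift b (g i) (G i)) ` I" using K(2) i(1) by blast
  qed
  ultimately show ?thesis using sup unfolding incidence_matrix_def by simp
qed

text \<open>The point may also be written \<open>x + u *\<^sub>R b\<close> with another
  \<open>x\<close> in \<open>G\<close>; comparing values of \<open>g\<close> shows that
  \<open>p\<close> and \<open>s\<close> are maximal themselves. Incidence thus becomes a sign
  condition, as in the blocks.\<close>

lemma mem_lift_iff:
  assumes G: "supports P g G" and "p \<in> P" and s: "s \<in> {1, -1}"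
  shows "p + s *\<^sub>R b \<in> lift b g G \<longleftrightarrow> p \<in> G \<and> s * (g \<bullet> b) = \<bar>g \<bullet> b\<bar>"
proof
  assume "p + s *\<^sub>R b \<in> lift b g G"
  then obtain x u where x: "x \<in> G" and u: "u * (g \<bullet> b) = \<bar>g \<bullet> b\<bar>"
    and eq: "p + s *\<^sub>R b = x + u *\<^sub>R b"
    unfolding lift_def by blast
  note G' = G[unfolded supports_at[OF x]]
  have "g \<bullet> p + s * (g \<bullet> b) = g \<bullet> x + \<bar>g \<bullet> b\<bar>"
    using arg_cong[OF eq, of "(\<bullet>) g"] u by (simp add: inner_add_right)
  moreover have "g \<bullet> p \<le> g \<bullet> x" using G' \<open>p \<in> P\<close> by blast
  moreover have "s * (g \<bullet> b) \<le> \<bar>g \<bullet> b\<bar>" using s by auto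
  ultimately show "p \<in> G \<and> s * (g \<bullet> b) = \<bar>g \<bullet> b\<bar>" using G' \<open>p \<in> P\<close> by auto
next
  assume "p \<in> G \<and> s * (g \<bullet> b) = \<bar>g \<bullet> b\<bar>"
  moreover have "\<bar>s\<bar> \<le> 1" using s by auto
  ultimately show "p + s *\<^sub>R b \<in> lift b g G" unfolding lift_def by blast
qed

text \<open>Guarantees that the row of a true facet is not zero. The witness is a vertex of
  \<open>G\<close>, lifted because of \<open>G\<close> itself if \<open>g\<close> is transversal,
  and otherwise because of any transversal facet through it, either sign being admissible.\<close>

lemma lift_contains_lifted_vertex:
  fixes P :: "'a::euclidean_space set"
  assumes P: "polytope P" and full: "aff_dim P = DIM('a)" and b: "b \<noteq> 0"
    and G: "supports P g G" "facet P G \<or> g \<bullet> b = 0"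
  obtains p s where "(p, s) \<in> lifted_vertices b P" "p \<in> G" "s * (g \<bullet> b) = \<bar>g \<bullet> b\<bar>"
proof -
  note result = that
  have "face P G" using G unfolding face_def by blast
  then obtain p where p: "vertex P p" "p \<in> G" using face_contains_vertex[OF P full] by blast
  have ex: thesis if F: "facet P F" "supports P f F" "p \<in> F" "f \<bullet> b \<noteq> 0"
    and s: "sgn (f \<bullet> b) * (g \<bullet> b) = \<bar>g \<bullet> b\<bar>" for F f
  proof (rule result[OF _ p(2) s])
    have "sgn (f \<bullet> b) * (f \<bullet> b) > 0" "sgn (f \<bullet> b) \<in> {1, -1}"
      using F(4) by (auto simp: sgn_real_def)
    then show "(p, sgn (f \<bullet> b)) \<in> lifted_vertices b P"
      unfolding lifted_vertices_def using p(1) F(1-3) by blast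
  qed
  show thesis
  proof (cases "g \<bullet> b = 0")
    case True
    obtain F f where "facet P F" "supports P f F" "p \<in> F" "f \<bullet> b \<noteq> 0"
      using vertex_on_transversal_facet[OF P full p(1) b] .
    from ex[OF this] True show thesis by simp
  next
    case False
    then show thesis
      using ex[OF _ G(1) p(2)] G(2) by (simp add: abs_sgn mult.commute)
  qed
qed

text \<open>\<open>f\<close> is a negative multiple of \<open>g\<close>, so \<open>x\<close> both
  maximises and minimises it over \<open>S\<close>. This keeps the combined normal at a ridge from
  vanishing.\<close>

lemma supports_opposite:
  assumes f: "supports S f F" and g: "supports S g G" and x: "x \<in> F" "x \<in> G"
    and c: "c > 0" and eq: "f + c *\<^sub>R g = 0"
  shows "F = S"
proof -
  note f' = f[unfolded supports_at[OF x(1)]] and g' = g[unfolded supports_at[OF x(2)]]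
  have "f \<bullet> y = f \<bullet> x" if "y \<in> S" for y
  proof -
    have "f \<bullet> z + c * (g \<bullet> z) = 0" for z
      using arg_cong[OF eq, of "\<lambda>w. w \<bullet> z"] by (simp add: inner_add_left)
    from this[of x] this[of y] have "f \<bullet> x + c * (g \<bullet> x) = f \<bullet> y + c * (g \<bullet> y)" by simp
    moreover have "c * (g \<bullet> y) \<le> c * (g \<bullet> x)" using g' that c by auto
    moreover have "f \<bullet> y \<le> f \<bullet> x" using f' that by blast
    ultimately show ?thesis by linarith
  qed
  then show ?thesis using f' by blast
qed

lemma polytope_prism:
  fixes P :: "'a::euclidean_space set"
  assumes "polytope P"
  shows "polytope (prism b P)"
proof -
  have "prism b P = (\<lambda>z. fst z + snd z *\<^sub>R b) ` (P \<times> cbox (-1) (1::real))"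
    (is "_ = ?h ` _")
  proof (intro equalityI subsetI)
    fix y assume "y \<in> prism b P"
    then obtain x u where "x \<in> P" "\<bar>u\<bar> \<le> 1" "y = ?h (x, u)" unfolding prism_def by auto
    then show "y \<in> ?h ` (P \<times> cbox (-1) (1::real))" by (intro image_eqI[of _ _ "(x, u)"]) auto
  qed (auto intro!: prismI)
  moreover have "linear (\<lambda>z::'a \<times> real. fst z + snd z *\<^sub>R b)"
    by (intro linearI) (auto simp: algebra_simps)
  moreover have "polytope (P \<times> cbox (-1) (1::real))"
    using assms polytope_interval by (rule polytope_Times)
  ultimately show ?thesis using polytope_linear_image by metis
qed

section \<open>Linear images\<close>

lemma image_Collect_eq:
  assumes "\<And>y. \<exists>x. y = f x" "\<And>x. Q (f x) \<longleftrightarrow> P x"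
  shows "{y. Q y} = f ` {x. P x}"
proof (intro equalityI subsetI)
  fix y assume y: "y \<in> {y. Q y}"
  obtain x where "y = f x" using assms(1) by blast
  with y assms(2) show "y \<in> f ` {x. P x}" by blast
qed (use assms(2) in auto)

text \<open>\<open>adj\<close> makes \<open>A'\<close> the inverse transpose of \<open>A\<close>:
  the value of \<open>A' g\<close> at \<open>A x\<close> is that of \<open>g\<close> at
  \<open>x\<close>, so supporting hyperplanes correspond.\<close>

lemma incidence_matrix_linear_image:
  fixes A A' :: "'a::euclidean_space \<Rightarrow> 'a"
  assumes lin: "linear A" and bij: "bij A" and surj: "surj A'"
    and adj: "\<And>g x. A' g \<bullet> A x = g \<bullet> x"
    and inc: "incidence_matrix S I J M v F f"
  shows "incidence_matrix (A ` S) I J M (A \<circ> v) (\<lambda>i. A ` F i) (A' \<circ> f)"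
proof -
  have inj: "inj A" using bij by (rule bij_is_inj)
  have nz: "A' g = 0 \<longleftrightarrow> g = 0" for g
  proof
    assume "A' g = 0"
    then have "g \<bullet> g = 0" using adj[of g g] by simp
    then show "g = 0" by simp
  next
    assume "g = 0"
    moreover obtain x where "A x = A' g" using bij by (metis bij_pointE)
    ultimately show "A' g = 0" using adj[of g x] by simp
  qed
  have sup: "supports (A ` S) (A' g) (A ` G) \<longleftrightarrow> supports S g G" for g G
  proof -
    have "A ` G = {y \<in> A ` S. A' g \<bullet> y = g \<bullet> p} \<longleftrightarrow> G = {y \<in> S. g \<bullet> y = g \<bullet> p}" for p
    proof -
      have "{y \<in> A ` S. A' g \<bullet> y = g \<bullet> p} = A ` {y \<in> S. g \<bullet> y = g \<bullet> p}"
        using adj by auto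
      then show ?thesis using inj by (simp add: inj_image_eq_iff)
    qed
    then show ?thesis unfolding supports_iff nz by (simp add: adj)
  qed
  \<comment> \<open>Every set is an image under \<open>A\<close>, so equivalences stated for images
    account for all faces of the target.\<close>
  have sub: "\<exists>G. H = A ` G" for H using bij by (metis bij_is_surj surj_image_vimage_eq)
  have face: "face (A ` S) (A ` G) \<longleftrightarrow> face S G" for G
    unfolding face_def using sup surj by (metis surjD)
  have facets: "{H. facet (A ` S) H} = (`) A ` {G. facet S G}"
  proof -
    have "facet (A ` S) (A ` G) \<longleftrightarrow> facet S G" for G
      unfolding facet_def face using lin inj by simp
    then show ?thesis using sub by (metis (no_types, lifting) image_Collect_eq)
  qed
  have vertices: "{q. vertex (A ` S) q} = A ` {p. vertex S p}"
  proof -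
    have "vertex (A ` S) (A p) \<longleftrightarrow> vertex S p" for p
      unfolding vertex_def using face[of "{p}"] by simp
    then show ?thesis using bij_is_surj[OF bij] by (metis image_Collect_eq surjD)
  qed
  have "bij_betw (A \<circ> v) J {q. vertex (A ` S) q}"
    unfolding vertices using inc inj
    by (auto simp: incidence_matrix_def intro: bij_betw_trans inj_on_imp_bij_betw inj_on_subset)
  moreover have "bij_betw ((`) A \<circ> F) I {H. facet (A ` S) H}"
    unfolding facets using inc inj
    by (auto simp: incidence_matrix_def inj_image_eq_iff inj_on_def
        intro!: bij_betw_trans[of F] inj_on_imp_bij_betw)
  ultimately show ?thesis
    using inc inj sup unfolding incidence_matrix_def by (simp add: inj_image_mem_iff comp_def)
qed

section \<open>The plant matrices\<close>

text \<open>Counting the indices up to \<open>i\<close> is strictly monotone, and an injection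
  between finite sets of equal size is onto.\<close>

lemma pos_bij: "bij_betw (pos :: 'n::{finite,linorder} \<Rightarrow> nat) UNIV {1..CARD('n)}"
proof -
  have "strict_mono (pos :: 'n \<Rightarrow> nat)"
    unfolding pos_def strict_mono_def by (auto intro!: psubset_card_mono)
  then have inj: "inj (pos :: 'n \<Rightarrow> nat)" by (rule strict_mono_imp_inj_on)
  have "pos i \<in> {1..CARD('n)}" for i :: 'n
    unfolding pos_def using card_gt_0_iff[of "{..i}"] by (auto simp: Suc_le_eq intro!: card_mono)
  then have "range (pos :: 'n \<Rightarrow> nat) \<subseteq> {1..CARD('n)}" by blast
  moreover have "card (range (pos :: 'n \<Rightarrow> nat)) = card {1..CARD('n)}"
    using card_image[OF inj] by simp
  ultimately have "range (pos :: 'n \<Rightarrow> nat) = {1..CARD('n)}" by (intro card_subset_eq) auto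
  then show ?thesis using inj unfolding bij_betw_def by blast
qed

lemma pos_range: "pos (i :: 'n::{finite,linorder}) \<in> {1..CARD('n)}"
  using pos_bij bij_betwE by blast

lemma pos_eq_iff: "pos i = pos j \<longleftrightarrow> i = j"
  using pos_bij unfolding bij_betw_def inj_on_def by blast

lemma pos_eq_1_iff: "pos i = 1 \<longleftrightarrow> i = Min UNIV"
proof -
  have "{..Min UNIV} = {Min UNIV :: 'a}" by (auto intro: antisym)
  then have "pos (Min UNIV :: 'a) = 1" unfolding pos_def by simp
  then show ?thesis using pos_eq_iff by metis
qed

lemma sum_pos: "(\<Sum>i\<in>UNIV. h (pos (i :: 'n::{finite,linorder}))) = (\<Sum>k=1..CARD('n). h k)"
  by (rule sum.reindex_bij_betw[OF pos_bij])

lemma transpose_dual_A_plant_A: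
  assumes "coeff den CARD('n::{finite,linorder}) \<noteq> 0"
  shows "transpose (dual_A den) ** plant_A den = (mat 1 :: real ^ 'n::{finite,linorder} ^ 'n::{finite,linorder})"
proof -
  let ?m = "CARD('n)"
  have "(\<Sum>r\<in>UNIV. dual_A den $ r $ c * plant_A den $ r $ c') = (if c = c' then 1 else 0)"
    for c c' :: 'n
  proof -
    let ?c = "pos c" and ?c' = "pos c'"
    define h where "h r =
        (if ?c = 1 then (if r < ?m then - coeff den (?m - r) / coeff den ?m else - 1 / coeff den ?m)
         else (if ?c = r + 1 then 1 else 0)) *
        (if r < ?m then (if ?c' = r + 1 then 1 else 0) else - coeff den (?m + 1 - ?c'))" for r
    have c: "1 \<le> ?c" "?c \<le> ?m" "1 \<le> ?c'" "?c' \<le> ?m" using pos_range[of c] pos_range[of c'] by auto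
    have "(\<Sum>r\<in>UNIV. dual_A den $ r $ c * plant_A den $ r $ c') = (\<Sum>r\<in>UNIV. h (pos (r :: 'n)))"
      unfolding dual_A_def plant_A_def h_def by simp
    also have "\<dots> = (\<Sum>r=1..?m. h r)" by (rule sum_pos)
    \<comment> \<open>The last row of \<open>plant_A\<close> carries the coefficients; every other
      row is a shift and contributes only at \<open>r = ?c' - 1\<close>, which does not exist for
      \<open>?c' = 1\<close>. For \<open>?c = 1 < ?c'\<close> the two coefficient terms
      cancel.\<close>
    also have "\<dots> = h ?m + (\<Sum>r\<in>{1..<?m}. h r)"
      using c by (simp add: sum.last_plus[of 1 ?m] atLeastLessThanSuc_atLeastAtMost[symmetric])
    also have "(\<Sum>r\<in>{1..<?m}. h r) = (\<Sum>r\<in>{1..<?m}. if r = ?c' - 1 then h r else 0)"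
      using c by (intro sum.cong) (auto simp: h_def)
    also have "\<dots> = (if ?c' = 1 then 0 else h (?c' - 1))"
      using c by auto
    also have "h ?m + \<dots> = (if ?c = ?c' then 1 else 0)"
      using c assms by (auto simp: h_def)
    finally show ?thesis by (simp add: pos_eq_iff)
  qed
  then show ?thesis
    by (simp add: vec_eq_iff matrix_matrix_mult_def transpose_def mat_def)
qed

lemma dual_A_inner_plant_A:
  fixes g x :: "real ^ 'n::{finite,linorder}"
  assumes "coeff den CARD('n) \<noteq> 0"
  shows "(dual_A den *v g) \<bullet> (plant_A den *v x) = g \<bullet> x"
proof -
  have "transpose (plant_A den) ** dual_A den
      = transpose (transpose (dual_A den) ** (plant_A den :: real ^ 'n::{finite,linorder} ^ 'n::{finite,linorder}))"
    by (simp add: matrix_transpose_mul transpose_transpose)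
  also have "\<dots> = mat 1" by (simp add: transpose_dual_A_plant_A[OF assms] transpose_mat)
  finally have "(dual_A den *v g) v* plant_A den = g"
    by (simp add: matrix_vector_mul_assoc flip: transpose_matrix_vector)
  then show ?thesis by (metis dot_lmul_matrix)
qed

lemma bij_plant_A:
  assumes "coeff den CARD('n::{finite,linorder}) \<noteq> 0"
  shows "bij ((*v) (plant_A den :: real ^ 'n::{finite,linorder} ^ 'n::{finite,linorder}))"
proof -
  let ?A = "plant_A den :: real ^ 'n::{finite,linorder} ^ 'n::{finite,linorder}"
  let ?D = "transpose (dual_A den) :: real ^ 'n::{finite,linorder} ^ 'n::{finite,linorder}"
  have "?D ** ?A = mat 1" "?A ** ?D = mat 1"
    using transpose_dual_A_plant_A[OF assms] matrix_left_right_inverse by blast+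
  then show ?thesis
    by (intro o_bij[of "(*v) ?D"])
      (auto simp: fun_eq_iff matrix_vector_mul_assoc simp del: transpose_matrix_vector)
qed

lemma surj_dual_A:
  assumes "coeff den CARD('n::{finite,linorder}) \<noteq> 0"
  shows "surj ((*v) (dual_A den :: real ^ 'n::{finite,linorder} ^ 'n::{finite,linorder}))"
proof (rule linear_inj_imp_surj)
  show "inj ((*v) (dual_A den :: real ^ 'n::{finite,linorder} ^ 'n::{finite,linorder}))"
  proof (rule injI)
    fix g h :: "real ^ 'n::{finite,linorder}"
    assume "dual_A den *v g = dual_A den *v h"
    then have "g \<bullet> x = h \<bullet> x" for x using dual_A_inner_plant_A[OF assms] by metis
    then show "g = h" by (metis vector_eq_rdot)
  qed
qed simp

section \<open>The input direction pulled back through the plant matrix\<close>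

definition input_preimage :: "real poly \<Rightarrow> real ^ 'n::{finite,linorder}" where
  "input_preimage den = (- 1 / coeff den CARD('n)) *\<^sub>R axis (Min UNIV) 1"

text \<open>No entry of the shift falls into the first column of \<open>plant_A\<close>, so its only
  non-zero entry is the last one, minus the leading coefficient.\<close>

lemma plant_A_input_preimage:
  assumes "coeff den CARD('n::{finite,linorder}) \<noteq> 0"
  shows "plant_A den *v input_preimage den = (plant_B :: real ^ 'n::{finite,linorder})"
proof -
  have "plant_A den *v input_preimage den
      = (- 1 / coeff den CARD('n)) *\<^sub>R column (Min UNIV :: 'n) (plant_A den)"
    unfolding input_preimage_def matrix_vector_mult_scaleR matrix_vector_mult_basis ..
  moreover have "((- 1 / coeff den CARD('n)) *\<^sub>R column (Min UNIV :: 'n) (plant_A den)) $ r = plant_B $ r"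
    for r :: 'n
  proof -
    have "pos (Min UNIV :: 'n) = 1" using pos_eq_1_iff by blast
    moreover have "1 \<le> pos r" "pos r \<le> CARD('n)" using pos_range[of r] by simp_all
    ultimately show ?thesis using assms by (auto simp: column_def plant_A_def plant_B_def)
  qed
  ultimately show ?thesis by (simp add: vec_eq_iff)
qed

lemma first_eq_inner:
  fixes x :: "real ^ 'n::{finite,linorder}"
  assumes "coeff den CARD('n) \<noteq> 0"
  shows "first x = - coeff den CARD('n) * (x \<bullet> input_preimage den)"
  using assms by (simp add: first_def input_preimage_def inner_axis)

text \<open>Starting from one point, each time step cuts with a strip, applies a linear map and adds
  a segment along \<open>plant_B\<close>; all three preserve polytopes.\<close>

lemma polytope_uncertainty_set: "polytope (uncertainty_set num den x0 z k)"
proof (induction k)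
  case 0
  have "uncertainty_set num den x0 z 0 = {x0}"
    unfolding uncertainty_set_def by (auto intro!: exI[of _ "\<lambda>_. x0"])
  then show ?case by (simp add: polytope_sing)
next
  case (Suc k)
  let ?S = "uncertainty_set num den x0 z k"
  let ?T = "?S \<inter> ({x. plant_C num \<bullet> x \<le> z k + 1} \<inter> {x. plant_C num \<bullet> x \<ge> z k - 1})"
  have "uncertainty_set num den x0 z (Suc k) = prism plant_B ((*v) (plant_A den) ` ?T)"
    unfolding uncertainty_set_Suc prism_def by (auto simp: abs_le_iff; fastforce)
  moreover have "polytope ?T"
    using Suc.IH by (intro polytope_Int_polyhedron polyhedron_Int polyhedron_halfspace_le polyhedron_halfspace_ge)
  ultimately show ?case by (simp add: polytope_prism polytope_linear_image)
qed

section \<open>The matrix \<open>\<I>\<^sup>+\<close>\<close>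

text \<open>The sign of \<open>dm\<close> decides whether \<open>first\<close> and the product with
  \<open>b\<close> agree in sign; disagreement merely swaps the two facets, in which the definition
  is symmetric.\<close>

lemma shadow_ridges_eq_turning_ridges:
  assumes "dm \<noteq> 0" and first: "\<And>x. first x = - dm * (x \<bullet> b)"
  shows "shadow_ridges b S = turning_ridges S"
proof (cases "dm > 0")
  case True
  then have "first f < 0 \<longleftrightarrow> f \<bullet> b > 0" "first f > 0 \<longleftrightarrow> f \<bullet> b < 0" for f
    unfolding first by (auto simp: zero_less_mult_iff mult_less_0_iff)
  then show ?thesis unfolding shadow_ridges_def turning_ridges_def by (auto simp: Int_commute)
next
  case False
  then have "dm < 0" using assms(1) by simp
  then have "first f < 0 \<longleftrightarrow> f \<bullet> b < 0" "first f > 0 \<longleftrightarrow> f \<bullet> b > 0" for f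
    unfolding first by (auto simp: zero_less_mult_iff mult_less_0_iff)
  then show ?thesis unfolding shadow_ridges_def turning_ridges_def by simp
qed

text \<open>Neither normal is tangential, so both weights are positive and \<open>h\<close> is a
  positive multiple of \<open>f + (w / u) *\<^sub>R g\<close>, to which \<open>supports_add\<close>
  applies.\<close>

lemma supports_ridge_direction:
  assumes full: "aff_dim S = DIM('a)"
    and F: "facet S F" "supports S f F" and G: "supports S g G" and x: "x \<in> F \<inter> G"
    and opp: "f \<bullet> b < 0" "g \<bullet> b > 0"
    and h: "h \<in> convex hull {f, g}" "h \<bullet> b = 0"
  shows "supports S (h :: 'a::euclidean_space) (F \<inter> G)"
proof -
  obtain u w where uw: "u \<ge> 0" "w \<ge> 0" "u + w = 1" "h = u *\<^sub>R f + w *\<^sub>R g"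
    using h(1) by (auto simp: convex_hull_2)
  have eq: "u * (f \<bullet> b) + w * (g \<bullet> b) = 0" using h(2) uw(4) by (simp add: inner_add_left)
  have "u \<noteq> 0" "w \<noteq> 0" using eq uw(3) opp by auto
  then have pos: "u > 0" "w / u > 0" using uw by auto
  have "F \<noteq> S" using F(1) full unfolding facet_def by auto
  then have "f + (w / u) *\<^sub>R g \<noteq> 0" using supports_opposite[OF F(2) G _ _ pos(2)] x by blast
  then have "supports S (f + (w / u) *\<^sub>R g) (F \<inter> G)"
    using supports_add[OF F(2) G _ _ pos(2)] x by blast
  moreover have "h = u *\<^sub>R (f + (w / u) *\<^sub>R g)" using pos(1) uw(4) by (simp add: scaleR_add_right)
  ultimately show ?thesis using supports_scale_iff[OF pos(1)] by metis
qed

text \<open>Any witnessing normal is a positive multiple of the listed one. For \<open>s = 1\<close>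
  and \<open>s = -1\<close> the right-hand side is what \<open>nonzero_col\<close> tests on the T
  and B blocks.\<close>

lemma incidence_lifted_vertices_iff:
  fixes P :: "'a::euclidean_space set"
  assumes full: "aff_dim P = DIM('a)" and inc: "incidence_matrix P I J M v F f"
    and j: "j \<in> J" and s: "s \<in> {1, -1}"
  shows "(v j, s) \<in> lifted_vertices b P \<longleftrightarrow> (\<exists>i\<in>I. M i j = 1 \<and> s * (f i \<bullet> b) > 0)"
proof
  assume "(v j, s) \<in> lifted_vertices b P"
  then obtain G g where G: "facet P G" "supports P g G" "v j \<in> G" "s * (g \<bullet> b) > 0"
    unfolding lifted_vertices_def by blast
  then have "G \<in> F ` I" using inc unfolding incidence_matrix_def bij_betw_def by blast
  then obtain i where i: "i \<in> I" "G = F i" by blast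
  then have "supports P (f i) G" using inc unfolding incidence_matrix_def by blast
  then obtain c where c: "c > 0" "f i = c *\<^sub>R g" using facet_normal_unique[OF full G(1,2)] by blast
  then have "s * (f i \<bullet> b) = c * (s * (g \<bullet> b))" by simp
  then have "s * (f i \<bullet> b) > 0" using mult_pos_pos[OF c(1) G(4)] by linarith
  moreover have "M i j = 1" using inc i j G(3) unfolding incidence_matrix_def by simp
  ultimately show "\<exists>i\<in>I. M i j = 1 \<and> s * (f i \<bullet> b) > 0" using i by blast
next
  assume "\<exists>i\<in>I. M i j = 1 \<and> s * (f i \<bullet> b) > 0"
  then obtain i where i: "i \<in> I" "M i j = 1" "s * (f i \<bullet> b) > 0" by blast
  have "v j \<in> F i" using inc i j unfolding incidence_matrix_def by (metis zero_neq_one)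
  moreover have "facet P (F i)" "supports P (f i) (F i)" "vertex P (v j)"
    using inc i(1) j unfolding incidence_matrix_def bij_betw_def by blast+
  ultimately show "(v j, s) \<in> lifted_vertices b P"
    unfolding lifted_vertices_def using s i(3) by blast
qed

text \<open>The directions of \<open>row_direction\<close> before \<open>dual_A\<close> is applied;
  polymorphic, so that the same indexing also lists the faces \<open>F\<close> and
  \<open>R\<close>.\<close>

definition base_row :: "nat \<Rightarrow> (nat \<Rightarrow> 'a) \<Rightarrow> (nat \<Rightarrow> 'a) \<Rightarrow> nat \<Rightarrow> 'a" where
  "base_row nf f fR r =
     (if r \<le> nf then f r else if r \<le> 2 * nf then f (r - nf)
      else if r \<le> 3 * nf then f (r - 2 * nf) else fR (r - 3 * nf))"

definition base_col :: "nat \<Rightarrow> (nat \<Rightarrow> 'a) \<Rightarrow> nat \<Rightarrow> 'a" where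
  "base_col nv v c = (if c \<le> nv then v c else v (c - nv))"

definition col_sign :: "nat \<Rightarrow> nat \<Rightarrow> real" where
  "col_sign nv c = (if c \<le> nv then 1 else -1)"

lemma row_cases:
  fixes r nf nR :: nat
  assumes "r \<in> {1..3 * nf + nR}"
  obtains (top) i where "i \<in> {1..nf}" "r = i"
    | (bottom) i where "i \<in> {1..nf}" "r = nf + i"
    | (tangent) i where "i \<in> {1..nf}" "r = 2 * nf + i"
    | (ridge) l where "l \<in> {1..nR}" "r = 3 * nf + l"
proof -
  consider "r \<in> {1..nf}" | "r - nf \<in> {1..nf}" "r = nf + (r - nf)"
    | "r - 2 * nf \<in> {1..nf}" "r = 2 * nf + (r - 2 * nf)"
    | "r - 3 * nf \<in> {1..nR}" "r = 3 * nf + (r - 3 * nf)"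
    using assms by fastforce
  then show thesis using top bottom tangent ridge by cases blast+
qed

lemma col_cases:
  fixes c nv :: nat
  assumes "c \<in> {1..2 * nv}"
  obtains (top) j where "j \<in> {1..nv}" "c = j" | (bottom) j where "j \<in> {1..nv}" "c = nv + j"
proof -
  consider "c \<in> {1..nv}" | "c - nv \<in> {1..nv}" "c = nv + (c - nv)"
    using assms by fastforce
  then show thesis using top bottom by cases blast+
qed

lemma base_row_simps:
  "i \<in> {1..nf} \<Longrightarrow> base_row nf f fR i = f i"
  "i \<in> {1..nf} \<Longrightarrow> base_row nf f fR (nf + i) = f i"
  "i \<in> {1..nf} \<Longrightarrow> base_row nf f fR (2 * nf + i) = f i"
  "1 \<le> l \<Longrightarrow> base_row nf f fR (3 * nf + l) = fR l"
  by (auto simp: base_row_def)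

lemma base_col_simps:
  "j \<in> {1..nv} \<Longrightarrow> base_col nv v j = v j" "j \<in> {1..nv} \<Longrightarrow> base_col nv v (nv + j) = v j"
  "j \<in> {1..nv} \<Longrightarrow> col_sign nv j = 1" "j \<in> {1..nv} \<Longrightarrow> col_sign nv (nv + j) = -1"
  by (auto simp: base_col_def col_sign_def)

lemma inc_plus_simps:
  fixes dm nf nv M v f R
  defines "N \<equiv> inc_plus dm nf nv M v f R"
    and "VT \<equiv> nonzero_col nf (inc_T dm f M)" and "VB \<equiv> nonzero_col nf (inc_B dm f M)"
  assumes j: "j \<in> {1..nv}"
  shows "i \<in> {1..nf} \<Longrightarrow> N i j = inc_T dm f M i j"
    "i \<in> {1..nf} \<Longrightarrow> N i (nv + j) = 0"
    "i \<in> {1..nf} \<Longrightarrow> N (nf + i) j = 0"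
    "i \<in> {1..nf} \<Longrightarrow> N (nf + i) (nv + j) = inc_B dm f M i j"
    "i \<in> {1..nf} \<Longrightarrow> N (2 * nf + i) j = inc_O f M VT i j"
    "i \<in> {1..nf} \<Longrightarrow> N (2 * nf + i) (nv + j) = inc_O f M VB i j"
    "1 \<le> l \<Longrightarrow> N (3 * nf + l) j = inc_R R v VT l j"
    "1 \<le> l \<Longrightarrow> N (3 * nf + l) (nv + j) = inc_R R v VB l j"
  using j unfolding N_def VT_def VB_def inc_plus_def Let_def by auto

theorem inc_plus_prism:
  fixes P :: "(real ^ 'n::{finite,linorder}) set"
  assumes P: "polytope P" and full: "aff_dim P = int CARD('n)" and b: "b \<noteq> 0"
    and dm: "dm \<noteq> 0" and first: "\<And>x. first x = - dm * (x \<bullet> b)"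
    and inc: "incidence_matrix P {1..nf} {1..nv} M v F f"
    and R: "bij_betw R {1..nR} (turning_ridges P)"
    and fR: "\<forall>l\<in>{1..nR}. \<exists>i\<in>{1..nf}. \<exists>i'\<in>{1..nf}.
           first (f i) < 0 \<and> first (f i') > 0 \<and> R l = F i \<inter> F i' \<and>
           fR l \<in> convex hull {f i, f i'} \<and> first (fR l) = 0"
  defines "M' \<equiv> inc_plus dm nf nv M v f R"
    and "g \<equiv> base_row nf f fR" and "G \<equiv> base_row nf F R"
    and "w \<equiv> base_col nv v" and "s \<equiv> col_sign nv"
  shows "incidence_matrix (prism b P) (nonzero_rows (3 * nf + nR) (2 * nv) M')
     (nonzero_cols (3 * nf + nR) (2 * nv) M') M' (\<lambda>c. w c + s c *\<^sub>R b)
     (\<lambda>r. lift b (g r) (G r)) g"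
proof -
  have full': "aff_dim P = DIM(real ^ 'n::{finite,linorder})" using full by simp
  \<comment> \<open>The rows predicted to survive: the block must match the sign of the normal on
    \<open>b\<close>. Ridge rows carry no condition.\<close>
  define rows where "rows = {r \<in> {1..3 * nf + nR}.
    (r \<le> nf \<longrightarrow> g r \<bullet> b > 0) \<and> (nf < r \<and> r \<le> 2 * nf \<longrightarrow> g r \<bullet> b < 0) \<and>
    (2 * nf < r \<and> r \<le> 3 * nf \<longrightarrow> g r \<bullet> b = 0)}"
  define cols where "cols = {c \<in> {1..2 * nv}. (w c, s c) \<in> lifted_vertices b P}"
  have v: "bij_betw v {1..nv} {p. vertex P p}" and F: "bij_betw F {1..nf} {H. facet P H}"
    and f: "\<And>i. i \<in> {1..nf} \<Longrightarrow> supports P (f i) (F i)"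
    and M: "\<And>i j. i \<in> {1..nf} \<Longrightarrow> j \<in> {1..nv} \<Longrightarrow> M i j = (if v j \<in> F i then 1 else 0)"
    using inc unfolding incidence_matrix_def by blast+
  have facetF: "facet P (F i)" if "i \<in> {1..nf}" for i using bij_betwE[OF F] that by blast
  have vP: "v j \<in> P" if "j \<in> {1..nv}" for j
    using bij_betwE[OF v] that supports_subset unfolding vertex_def face_def by blast
  have s_cases: "s c \<in> {1, -1}" for c unfolding s_def col_sign_def by simp
  note ridges = shadow_ridges_eq_turning_ridges[OF dm first, of P]
  have R': "R l \<in> shadow_ridges b P" if "l \<in> {1..nR}" for l
    using bij_betwE[OF R] that ridges by blast
  have ridge_nonempty: "R l \<noteq> {}" if "l \<in> {1..nR}" for l
    using R'[OF that] supports_nonempty unfolding shadow_ridges_def ridge_def face_def by blast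
  have not_facet: "\<not> facet P (R l)" if "l \<in> {1..nR}" for l
    using R'[OF that] unfolding shadow_ridges_def ridge_def facet_def by auto
  have fRb: "fR l \<bullet> b = 0" if "l \<in> {1..nR}" for l
    using fR that dm unfolding first by fastforce
  have supR: "supports P (fR l) (R l)" if l: "l \<in> {1..nR}" for l
  proof -
    obtain i i' where i: "i \<in> {1..nf}" "i' \<in> {1..nf}" "first (f i) < 0" "first (f i') > 0"
      "R l = F i \<inter> F i'" "fR l \<in> convex hull {f i, f i'}"
      using fR l by blast
    obtain x where x: "x \<in> F i \<inter> F i'" using ridge_nonempty[OF l] i(5) by blast
    consider "f i \<bullet> b < 0" "f i' \<bullet> b > 0" | "f i \<bullet> b > 0" "f i' \<bullet> b < 0"
      using i(3,4) unfolding first by (auto simp: zero_less_mult_iff mult_less_0_iff)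
    then show ?thesis
    proof cases
      case 1
      show ?thesis unfolding i(5)
        by (rule supports_ridge_direction[OF full' facetF[OF i(1)] f[OF i(1)] f[OF i(2)] x 1 i(6) fRb[OF l]])
    next
      case 2
      have "fR l \<in> convex hull {f i', f i}" "x \<in> F i' \<inter> F i" using i(6) x by (auto simp: insert_commute)
      from supports_ridge_direction[OF full' facetF[OF i(2)] f[OF i(2)] f[OF i(1)] this(2) 2(2,1) this(1) fRb[OF l]]
      show ?thesis unfolding i(5) by (simp add: Int_commute)
    qed
  qed
  have sup: "supports P (g r) (G r)" if "r \<in> {1..3 * nf + nR}" for r
    using that by (cases rule: row_cases) (simp_all add: g_def G_def base_row_simps f supR)
  have facet_or_tangential: "facet P (G r) \<or> g r \<bullet> b = 0" if "r \<in> {1..3 * nf + nR}" for r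
    using that
    by (cases rule: row_cases) (simp_all add: g_def G_def base_row_simps facetF fRb)
  have wv: "\<exists>j\<in>{1..nv}. w c = v j" if "c \<in> {1..2 * nv}" for c
    using that by (cases rule: col_cases) (auto simp: w_def base_col_simps)
  \<comment> \<open>\<open>dm * first x\<close> is \<open>- dm^2 * (x \<bullet> b)\<close>, so the
    factor \<open>dm\<close> frees the block conditions from the sign of \<open>dm\<close>.\<close>
  have sign: "dm * first x < 0 \<longleftrightarrow> x \<bullet> b > 0" "dm * first x > 0 \<longleftrightarrow> x \<bullet> b < 0"
    "first x = 0 \<longleftrightarrow> x \<bullet> b = 0" for x
    using dm by (auto simp: first zero_less_mult_iff mult_less_0_iff)
  have VT: "nonzero_col nf (inc_T dm f M) j = 1 \<longleftrightarrow> (v j, 1) \<in> lifted_vertices b P"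
    and VB: "nonzero_col nf (inc_B dm f M) j = 1 \<longleftrightarrow> (v j, -1) \<in> lifted_vertices b P"
    if j: "j \<in> {1..nv}" for j
    using incidence_lifted_vertices_iff[OF full' inc j, of 1 b]
      incidence_lifted_vertices_iff[OF full' inc j, of "-1" b]
    unfolding nonzero_col_def inc_T_def inc_B_def by (simp_all add: sign)
  have row: "i \<in> {1..nf} \<Longrightarrow> i \<in> rows \<longleftrightarrow> f i \<bullet> b > 0"
    "i \<in> {1..nf} \<Longrightarrow> nf + i \<in> rows \<longleftrightarrow> f i \<bullet> b < 0"
    "i \<in> {1..nf} \<Longrightarrow> 2 * nf + i \<in> rows \<longleftrightarrow> f i \<bullet> b = 0"
    "i \<in> {1..nR} \<Longrightarrow> 3 * nf + i \<in> rows" for i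
    by (auto simp: rows_def g_def base_row_simps)
  \<comment> \<open>The central identity: each entry is geometric incidence, restricted to the
    predicted rows and columns. The zero rows and columns can then be found by geometry
    alone.\<close>
  have entry: "M' r c = (if r \<in> rows \<and> c \<in> cols \<and> w c + s c *\<^sub>R b \<in> lift b (g r) (G r) then 1 else 0)"
    if r: "r \<in> {1..3 * nf + nR}" and c: "c \<in> {1..2 * nv}" for r c
  proof -
    obtain j where "j \<in> {1..nv}" "w c = v j" using wv[OF c] by blast
    then have wP: "w c \<in> P" using vP[of j] by simp
    \<comment> \<open>An incidence in block T or B is itself the facet witnessing that its column is
      in \<open>cols\<close>; in the two lower blocks the column vectors supply that test.\<close>
    have T: "v j \<in> F i \<and> f i \<bullet> b > 0 \<longrightarrow> (v j, 1) \<in> lifted_vertices b P"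
      and B: "v j \<in> F i \<and> f i \<bullet> b < 0 \<longrightarrow> (v j, -1) \<in> lifted_vertices b P"
      if "i \<in> {1..nf}" "j \<in> {1..nv}" for i j
      using facetF[OF that(1)] f[OF that(1)] bij_betwE[OF v] that(2)
      unfolding lifted_vertices_def by fastforce+
    have col: "j \<in> {1..nv} \<Longrightarrow> j \<in> cols \<longleftrightarrow> (v j, 1) \<in> lifted_vertices b P"
      "j \<in> {1..nv} \<Longrightarrow> nv + j \<in> cols \<longleftrightarrow> (v j, -1) \<in> lifted_vertices b P" for j
      by (auto simp: cols_def w_def s_def base_col_simps)
    have abs: "1 * x = \<bar>x\<bar> \<longleftrightarrow> x \<ge> 0" "-1 * x = \<bar>x\<bar> \<longleftrightarrow> x \<le> 0" for x :: real by auto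
    have mem: "w c + s c *\<^sub>R b \<in> lift b (g r) (G r) \<longleftrightarrow> w c \<in> G r \<and> s c * (g r \<bullet> b) = \<bar>g r \<bullet> b\<bar>"
      by (rule mem_lift_iff[OF sup[OF r] wP s_cases])
    show ?thesis unfolding mem
      using c
    proof (cases rule: col_cases)
      case j: (top j)
      note J = j(2) w_def s_def base_col_simps(1,3)[OF j(1)] col(1)[OF j(1)]
      show "M' r c = (if r \<in> rows \<and> c \<in> cols \<and> w c \<in> G r \<and> s c * (g r \<bullet> b) = \<bar>g r \<bullet> b\<bar> then 1 else 0)"
        using r
      proof (cases rule: row_cases)
        case (top i)
        show ?thesis
          unfolding top(2) J M'_def abs inc_plus_simps(1)[OF j(1) top(1)] g_def G_def
            base_row_simps(1)[OF top(1)] row(1)[OF top(1)] inc_T_def sign M[OF top(1) j(1)]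
          using T[OF top(1) j(1)] by (cases "f i \<bullet> b > 0"; cases "v j \<in> F i") simp_all
      next
        case (bottom i)
        show ?thesis
          unfolding bottom(2) J M'_def abs inc_plus_simps(3)[OF j(1) bottom(1)] g_def G_def
            base_row_simps(2)[OF bottom(1)] row(2)[OF bottom(1)]
          by auto
      next
        case (tangent i)
        show ?thesis
          unfolding tangent(2) J M'_def abs inc_plus_simps(5)[OF j(1) tangent(1)] g_def G_def
            base_row_simps(3)[OF tangent(1)] row(3)[OF tangent(1)] inc_O_def VT[OF j(1)] sign M[OF tangent(1) j(1)]
          by auto
      next
        case (ridge l)
        from ridge(1) have l: "1 \<le> l" by simp
        show ?thesis
          unfolding ridge(2) J M'_def abs inc_plus_simps(7)[OF j(1) l] g_def G_def
            base_row_simps(4)[OF l] inc_R_def VT[OF j(1)] fRb[OF ridge(1)]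
          using row(4)[OF ridge(1)] by auto
      qed
    next
      case j: (bottom j)
      note J = j(2) w_def s_def base_col_simps(2,4)[OF j(1)] col(2)[OF j(1)]
      show "M' r c = (if r \<in> rows \<and> c \<in> cols \<and> w c \<in> G r \<and> s c * (g r \<bullet> b) = \<bar>g r \<bullet> b\<bar> then 1 else 0)"
        using r
      proof (cases rule: row_cases)
        case (top i)
        show ?thesis
          unfolding top(2) J M'_def abs inc_plus_simps(2)[OF j(1) top(1)] g_def G_def
            base_row_simps(1)[OF top(1)] row(1)[OF top(1)]
          by auto
      next
        case (bottom i)
        show ?thesis
          unfolding bottom(2) J M'_def abs inc_plus_simps(4)[OF j(1) bottom(1)] g_def G_def
            base_row_simps(2)[OF bottom(1)] row(2)[OF bottom(1)] inc_B_def sign M[OF bottom(1) j(1)]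
          using B[OF bottom(1) j(1)] by (cases "f i \<bullet> b < 0"; cases "v j \<in> F i") simp_all
      next
        case (tangent i)
        show ?thesis
          unfolding tangent(2) J M'_def abs inc_plus_simps(6)[OF j(1) tangent(1)] g_def G_def
            base_row_simps(3)[OF tangent(1)] row(3)[OF tangent(1)] inc_O_def VB[OF j(1)] sign M[OF tangent(1) j(1)]
          by auto
      next
        case (ridge l)
        from ridge(1) have l: "1 \<le> l" by simp
        show ?thesis
          unfolding ridge(2) J M'_def abs inc_plus_simps(8)[OF j(1) l] g_def G_def
            base_row_simps(4)[OF l] inc_R_def VB[OF j(1)] fRb[OF ridge(1)]
          using row(4)[OF ridge(1)] by auto
      qed
    qed
  qed
  have rows_eq: "nonzero_rows (3 * nf + nR) (2 * nv) M' = rows"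
  proof (intro equalityI subsetI)
    fix r assume "r \<in> nonzero_rows (3 * nf + nR) (2 * nv) M'"
    then show "r \<in> rows" unfolding nonzero_rows_def using entry by (force split: if_splits)
  next
    fix r assume r: "r \<in> rows"
    then have r': "r \<in> {1..3 * nf + nR}" unfolding rows_def by simp
    obtain p t where p: "(p, t) \<in> lifted_vertices b P" "p \<in> G r" "t * (g r \<bullet> b) = \<bar>g r \<bullet> b\<bar>"
      using lift_contains_lifted_vertex[OF P full' b sup[OF r'] facet_or_tangential[OF r']] .
    then have t: "t \<in> {1, -1}" "vertex P p" unfolding lifted_vertices_def by blast+
    then obtain j where j: "j \<in> {1..nv}" "p = v j" using v unfolding bij_betw_def by blast
    define c where "c = (if t = 1 then j else j + nv)"
    have c: "c \<in> {1..2 * nv}" "w c = p" "s c = t"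
      using j t(1) by (auto simp: c_def w_def s_def base_col_def col_sign_def)
    then have "c \<in> cols" unfolding cols_def using p(1) by simp
    moreover have "p \<in> P" using p(2) supports_subset[OF sup[OF r']] by blast
    then have "w c + s c *\<^sub>R b \<in> lift b (g r) (G r)"
      unfolding c(2,3) using mem_lift_iff[OF sup[OF r'] _ t(1)] p(2,3) by blast
    ultimately have "M' r c \<noteq> 0" using entry[OF r' c(1)] r by simp
    then show "r \<in> nonzero_rows (3 * nf + nR) (2 * nv) M'"
      unfolding nonzero_rows_def using r' c(1) by blast
  qed
  have cols_eq: "nonzero_cols (3 * nf + nR) (2 * nv) M' = cols"
  proof (intro equalityI subsetI)
    fix c assume "c \<in> nonzero_cols (3 * nf + nR) (2 * nv) M'"
    then show "c \<in> cols" unfolding nonzero_cols_def using entry by (force split: if_splits)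
  next
    fix c assume c: "c \<in> cols"
    then have c': "c \<in> {1..2 * nv}" "(w c, s c) \<in> lifted_vertices b P" unfolding cols_def by auto
    then obtain j where j: "j \<in> {1..nv}" "w c = v j" using wv by blast
    obtain i where i: "i \<in> {1..nf}" "M i j = 1" "s c * (f i \<bullet> b) > 0"
      using c'(2) incidence_lifted_vertices_iff[OF full' inc j(1) s_cases] unfolding j(2) by blast
    \<comment> \<open>The facet witnessing the lifted vertex sits in block T for sign 1 and in block
      B for sign -1.\<close>
    define r where "r = (if s c = 1 then i else nf + i)"
    have r: "r \<in> {1..3 * nf + nR}" "g r = f i" "G r = F i"
      using i(1) by (auto simp: r_def g_def G_def base_row_def)
    have "r \<in> rows" using row(1,2)[OF i(1)] i(3) s_cases[of c] by (auto simp: r_def)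
    moreover have "v j \<in> F i" using M[OF i(1) j(1)] i(2) by (metis zero_neq_one)
    moreover have "s c * (f i \<bullet> b) = \<bar>f i \<bullet> b\<bar>" using i(3) s_cases[of c] by auto
    ultimately have "r \<in> rows" "w c + s c *\<^sub>R b \<in> lift b (g r) (G r)"
      using mem_lift_iff[OF sup[OF r(1)] vP[OF j(1)] s_cases, of c b] unfolding r j(2) by blast+
    then have "M' r c \<noteq> 0" using entry[OF r(1) c'(1)] c by simp
    then show "c \<in> nonzero_cols (3 * nf + nR) (2 * nv) M'"
      unfolding nonzero_cols_def using r c'(1) by blast
  qed
  \<comment> \<open>Selects, by the sign of the normal on \<open>b\<close>, the one surviving copy
    of facet \<open>i\<close> among its three; hence the row enumeration has no repetition.\<close>
  define facet_row where
    "facet_row i = (if f i \<bullet> b > 0 then i else if f i \<bullet> b < 0 then nf + i else 2 * nf + i)" for i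
  have active_row: "(\<exists>i\<in>{1..nf}. r = facet_row i \<and> G r = F i) \<or> (\<exists>l\<in>{1..nR}. r = 3 * nf + l \<and> G r = R l)"
    if r: "r \<in> rows" for r
  proof -
    have "r \<in> {1..3 * nf + nR}" using r unfolding rows_def by blast
    then show ?thesis
    proof (cases rule: row_cases)
      case (top i)
      then have "r = facet_row i" "G r = F i" using r row by (auto simp: facet_row_def G_def base_row_simps)
      then show ?thesis using top(1) by blast
    next
      case (bottom i)
      then have "r = facet_row i" "G r = F i" using r row by (auto simp: facet_row_def G_def base_row_simps)
      then show ?thesis using bottom(1) by blast
    next
      case (tangent i)
      then have "r = facet_row i" "G r = F i" using r row by (auto simp: facet_row_def G_def base_row_simps)
      then show ?thesis using tangent(1) by blast
    next
      case (ridge l)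
      then have "G r = R l" by (auto simp: G_def base_row_simps)
      then show ?thesis using ridge by blast
    qed
  qed
  have Finj: "i = i'" if "F i = F i'" "i \<in> {1..nf}" "i' \<in> {1..nf}" for i i'
    using F that unfolding bij_betw_def inj_on_def by blast
  have Rinj: "l = l'" if "R l = R l'" "l \<in> {1..nR}" "l' \<in> {1..nR}" for l l'
    using R that unfolding bij_betw_def inj_on_def by blast
  have FR: "F i \<noteq> R l" if "i \<in> {1..nf}" "l \<in> {1..nR}" for i l
    using facetF[OF that(1)] not_facet[OF that(2)] by metis
  have Gbij: "bij_betw G rows ({H. facet P H} \<union> shadow_ridges b P)"
    unfolding bij_betw_def
  proof (intro conjI inj_onI equalityI subsetI)
    fix r r' assume rr: "r \<in> rows" "r' \<in> rows" "G r = G r'"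
    show "r = r'"
      using active_row[OF rr(1)] active_row[OF rr(2)] unfolding rr(3) using Finj Rinj FR by metis
  next
    fix H assume "H \<in> G ` rows"
    then obtain r where "r \<in> rows" "H = G r" by blast
    then show "H \<in> {H. facet P H} \<union> shadow_ridges b P"
      using active_row[of r] facetF R' by force
  next
    fix H assume "H \<in> {H. facet P H} \<union> shadow_ridges b P"
    then have "H \<in> F ` {1..nf} \<union> R ` {1..nR}"
      using bij_betw_imp_surj_on[OF F] bij_betw_imp_surj_on[OF R] ridges by simp
    then consider i where "i \<in> {1..nf}" "H = F i" | l where "l \<in> {1..nR}" "H = R l" by blast
    then show "H \<in> G ` rows"
    proof cases
      case 1
      have "facet_row i \<in> rows" using row(1-3)[OF 1(1)] by (auto simp: facet_row_def)
      moreover have "G (facet_row i) = H" using 1 by (auto simp: facet_row_def G_def base_row_simps)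
      ultimately show ?thesis by blast
    next
      case 2
      then have "3 * nf + l \<in> rows" "G (3 * nf + l) = H" using row(4) by (auto simp: G_def base_row_simps)
      then show ?thesis by blast
    qed
  qed
  have col_index: "\<exists>j\<in>{1..nv}. w c = v j \<and> c = (if s c = 1 then j else nv + j)"
    if "c \<in> cols" for c
  proof -
    have "c \<in> {1..2 * nv}" using that unfolding cols_def by blast
    then show ?thesis by (cases rule: col_cases) (auto simp: w_def s_def base_col_simps)
  qed
  have wbij: "bij_betw (\<lambda>c. (w c, s c)) cols (lifted_vertices b P)"
    unfolding bij_betw_def
  proof (intro conjI inj_onI equalityI subsetI)
    fix c c' assume cc: "c \<in> cols" "c' \<in> cols" "(w c, s c) = (w c', s c')"
    obtain j where j: "j \<in> {1..nv}" "w c = v j" "c = (if s c = 1 then j else nv + j)"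
      using col_index[OF cc(1)] by blast
    obtain j' where j': "j' \<in> {1..nv}" "w c' = v j'" "c' = (if s c' = 1 then j' else nv + j')"
      using col_index[OF cc(2)] by blast
    have "v j = v j'" using cc(3) j(2) j'(2) by simp
    then have "j = j'" using v j(1) j'(1) unfolding bij_betw_def inj_on_def by blast
    moreover have "s c = s c'" using cc(3) by simp
    ultimately show "c = c'" using j(3) j'(3) by metis
  next
    fix q assume "q \<in> (\<lambda>c. (w c, s c)) ` cols"
    then show "q \<in> lifted_vertices b P" unfolding cols_def by blast
  next
    fix q assume q: "q \<in> lifted_vertices b P"
    obtain p t where pt: "q = (p, t)" by (cases q)
    then have t: "t \<in> {1, -1}" "vertex P p" using q unfolding lifted_vertices_def by blast+
    then obtain j where j: "j \<in> {1..nv}" "p = v j" using v unfolding bij_betw_def by blast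
    define c where "c = (if t = 1 then j else j + nv)"
    have c: "c \<in> {1..2 * nv}" "w c = p" "s c = t"
      using j t(1) by (auto simp: c_def w_def s_def base_col_def col_sign_def)
    then have "c \<in> cols" unfolding cols_def using q pt by simp
    then show "q \<in> (\<lambda>c. (w c, s c)) ` cols" using c pt by blast
  qed
  have sub: "rows \<subseteq> {1..3 * nf + nR}" "cols \<subseteq> {1..2 * nv}" unfolding rows_def cols_def by auto
  \<comment> \<open>A ridge is too small to be a facet, so \<open>facet_or_tangential\<close> leaves
    the tangential case.\<close>
  have gb0: "g r \<bullet> b = 0" if "r \<in> rows" "G r \<in> shadow_ridges b P" for r
    using that sub facet_or_tangential[of r] unfolding shadow_ridges_def ridge_def facet_def by auto
  have "incidence_matrix (prism b P) rows cols
           (\<lambda>i j. if w j + s j *\<^sub>R b \<in> lift b (g i) (G i) then 1 else 0)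
           (\<lambda>j. w j + s j *\<^sub>R b) (\<lambda>i. lift b (g i) (G i)) g"
    using sup sub gb0 by (intro prism_incidence_matrix P full' b Gbij wbij) auto
  moreover have "M' r c = (if w c + s c *\<^sub>R b \<in> lift b (g r) (G r) then 1 else 0)"
    if "r \<in> rows" "c \<in> cols" for r c
    using entry[OF subsetD[OF sub(1) that(1)] subsetD[OF sub(2) that(2)]] that by simp
  ultimately show ?thesis
    unfolding rows_eq cols_eq incidence_matrix_def by simp
qed

theorem mainTheorem1:
  fixes num den :: "real poly"
    and x0 :: "real ^ 'n::{finite,linorder}"
    and z :: "nat \<Rightarrow> real" and k :: nat
    and S S\<^sub>z S' :: "(real ^ 'n::{finite,linorder}) set"
    and nv nf nR :: nat
    and v f fR :: "nat \<Rightarrow> real ^ 'n::{finite,linorder}"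
    and F R :: "nat \<Rightarrow> (real ^ 'n::{finite,linorder}) set"
    and M :: "nat \<Rightarrow> nat \<Rightarrow> nat"
  assumes "coprime num den"
    and "degree num \<le> CARD('n)" and "coeff num 0 = 0"
    and "degree den \<le> CARD('n)" and "coeff den 0 = 1" and "coeff den CARD('n) \<noteq> 0"
    and "S = uncertainty_set num den x0 z k"
    and "S' = {plant_A den *v x + u *\<^sub>R plant_B | x u.
                 x \<in> S \<and> \<bar>u\<bar> \<le> 1 \<and> \<bar>plant_C num \<bullet> x - z k\<bar> \<le> 1}"
    and "S\<^sub>z = {x \<in> S. \<bar>plant_C num \<bullet> x - z k\<bar> \<le> 1}"
    and "aff_dim S\<^sub>z = int CARD('n)"
    and "incidence_matrix S\<^sub>z {1..nf} {1..nv} M v F f"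
    and "bij_betw R {1..nR} (turning_ridges S\<^sub>z)"
    and "\<forall>l\<in>{1..nR}. \<exists>i\<in>{1..nf}. \<exists>i'\<in>{1..nf}.
           first (f i) < 0 \<and> first (f i') > 0 \<and> R l = F i \<inter> F i' \<and>
           fR l \<in> convex hull {f i, f i'} \<and> first (fR l) = 0"
  shows "let M' = inc_plus (coeff den CARD('n)) nf nv M v f R;
             rows = nonzero_rows (3 * nf + nR) (2 * nv) M';
             cols = nonzero_cols (3 * nf + nR) (2 * nv) M'
         in \<exists>F'. incidence_matrix S' rows cols M'
                   (col_state den nv v) F' (row_direction den nf f fR)"


proof -
  note den = \<open>coeff den CARD('n) \<noteq> 0\<close>
  let ?A = "(*v) (plant_A den) :: real ^ 'n::{finite,linorder} \<Rightarrow> real ^ 'n::{finite,linorder}"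
  let ?b = "input_preimage den :: real ^ 'n::{finite,linorder}"
  let ?M = "inc_plus (coeff den CARD('n)) nf nv M v f R"
  have b: "?b \<noteq> 0" using den by (auto simp: input_preimage_def axis_eq_0_iff)
  have "S\<^sub>z = S \<inter> ({x. plant_C num \<bullet> x \<le> z k + 1} \<inter> {x. plant_C num \<bullet> x \<ge> z k - 1})"
    unfolding assms(9) by (auto simp: abs_le_iff)
  then have P: "polytope S\<^sub>z"
    using assms(7) polytope_uncertainty_set
    by (metis polytope_Int_polyhedron polyhedron_Int polyhedron_halfspace_le polyhedron_halfspace_ge)
  have S': "S' = ?A ` prism ?b S\<^sub>z"
  proof -
    have "plant_A den *v x + u *\<^sub>R plant_B = ?A (x + u *\<^sub>R ?b)" for x u
      by (simp add: matrix_vector_right_distrib matrix_vector_mult_scaleR plant_A_input_preimage[OF den])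
    then have "y \<in> S' \<longleftrightarrow> (\<exists>x u. y = ?A (x + u *\<^sub>R ?b) \<and> x \<in> S\<^sub>z \<and> \<bar>u\<bar> \<le> 1)" for y
      unfolding assms(8) assms(9) by auto
    then show ?thesis unfolding prism_def by blast
  qed
  have state: "col_state den nv v = (\<lambda>c. ?A (base_col nv v c + col_sign nv c *\<^sub>R ?b))"
  proof -
    have "?A (x + ?b) = ?A x + plant_B" "?A (x - ?b) = ?A x - plant_B" for x
      using plant_A_input_preimage[OF den]
      by (simp_all add: matrix_vector_right_distrib matrix_vector_mult_diff_distrib)
    then show ?thesis by (auto simp: fun_eq_iff col_state_def base_col_def col_sign_def)
  qed
  have direction: "row_direction den nf f fR = (\<lambda>r. dual_A den *v base_row nf f fR r)"
    by (simp add: fun_eq_iff row_direction_def base_row_def)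
  have "incidence_matrix (prism ?b S\<^sub>z) (nonzero_rows (3 * nf + nR) (2 * nv) ?M)
     (nonzero_cols (3 * nf + nR) (2 * nv) ?M) ?M
     (\<lambda>c. base_col nv v c + col_sign nv c *\<^sub>R ?b)
     (\<lambda>r. lift ?b (base_row nf f fR r) (base_row nf F R r)) (base_row nf f fR)"
    by (rule inc_plus_prism) (use assms P b first_eq_inner in \<open>simp_all\<close>)
  \<comment> \<open>The witness for \<open>F'\<close> maps a row to the image under
    \<open>plant_A\<close> of its lifted face.\<close>
  from incidence_matrix_linear_image[OF _ bij_plant_A[OF den] surj_dual_A[OF den] dual_A_inner_plant_A[OF den] this]
  show ?thesis unfolding S' state direction Let_def comp_def by auto
qed

end
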